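(* Let $m_0\le m_1$ be real numbers, $0<\rho\le 1$, and let $a\in H\Gamma_{\rho}^{m_{1},m_{0}}(\mathbb{R}^{2n})$. Then the Bopp pseudo-differential operator $\widetilde{A}_{B}=a\star$ satisfies $\widetilde{A}_{B}\in\widetilde{HG}_{\rho}^{m_{1},m_{0}}(\mathbb{R}^{4n})$.
   Context: Every linear continuous $A:\mathcal{S}(\mathbb{R}^{m})\to\mathcal{S}'(\mathbb{R}^{m})$ has a unique Weyl symbol $a\in\mathcal{S}'(\mathbb{R}^{2m})$, written $A=\operatorname{Op}^w(a)$, with $A\psi(x)=(2\pi)^{-m}\int_{\mathbb{R}^{2m}}e^{i(x-y)\cdot\xi}a(\tfrac12(x+y),\xi)\psi(y)\,dy\,d\xi$ (in the sense of distributions). $\operatorname{Sp}(2m,\mathbb{R})$ is the group of linear automorphisms of $\mathbb{R}^{m}_x\times\mathbb{R}^m_\xi$ preserving $\sigma_m((x,\xi),(x',\xi'))=\xi\cdot x'-\xi'\cdot x$. Bopp operator: for $a\in\mathcal{S}'(\mathbb{R}^{2n})$, $\widetilde A_B:\mathcal{S}(\mathbb{R}^{2n})\to\mathcal{S}'(\mathbb{R}^{2n})$ is formally $\widetilde A_B\Psi=a\star\Psi$, where $\star$ is the Moyal product $$a\star b(z)=\left(\tfrac{1}{4\pi}\right)^{2n}\int_{\mathbb{R}^{2n}\times\mathbb{R}^{2n}}e^{-\frac i2\sigma_n(v,u)}a(z+\tfrac12u)\,b(z-\tfrac12v)\,du\,dv .$$ Precisely (a known fact), it is the Weyl operator on $\mathbb{R}^{2n}=\mathbb{R}^n_x\times\mathbb{R}^n_y$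 with symbol $\widetilde a_B(x,y;\xi,\eta)=a(x-\frac12\eta,\,y+\frac12\xi)$, where $(\xi,\eta)\in\mathbb{R}^n\times\mathbb{R}^n$ is dual to $(x,y)$. Symplectic dimensional extension of symbols (from $\mathbb{R}^{2(N-k)}$ to $\mathbb{R}^{2N}$): write points of $\mathbb{R}^{2N}$ as $(x,y;\xi,\eta)$ with $x,\xi\in\mathbb{R}^{N-k}$, $y,\eta\in\mathbb{R}^k$. For $a\in\mathcal{S}'(\mathbb{R}^{2(N-k)})$ and $s\in\operatorname{Sp}(2N,\mathbb{R})$ put $(a\otimes1_{2k})(x,y;\xi,\eta)=a(x,\xi)$ and $E_s[a]=(a\otimes 1_{2k})\circ s$. Shubin class: for real $m_0\le m_1$ and $0<\rho\le1$, $H\Gamma_\rho^{m_1,m_0}(\mathbb{R}^{2m})$ is the set of $a\in C^\infty(\mathbb{R}^{2m})$ such that for $|z|$ sufficiently large $C_0|z|^{m_0}\le|a(z)|\le C_1|z|^{m_1}$ for some $C_0,C_1>0$ and, for every $\alpha\in\mathbb{N}^{2m}$, there is $C_\alpha\ge0$ with $|\partial_z^\alpha a(z)|\le C_\alpha|a(z)||z|^{-\rho|\alpha|}$. Extended Shubin class: $\widetilde{HG}_\rho^{m_1,m_0}(\mathbb{R}^{2N})$ is the set of operators with Weyl symbol $E_s[a]\in C^\infty(\mathbb{R}^{2N})$ for some $k\in\{0,\dots,N-1\}$, $a\in H\Gamma_\rho^{m_1,m_0}(\mathbb{R}^{2(N-k)})$ and $s\in\operatorname{Sp}(2N,\mathbb{R})$.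 *)

theory Defs
  imports "HOL-Analysis.Analysis"
begin

section \<open>Smooth functions, Schwartz functions, tempered distributions\<close>

text \<open>A multi-index is given by a list of basis vectors, one entry for each differentiation; its
  order is the length of the list. For smooth functions the order of the entries is immaterial.\<close>

fun pderivs :: "'a::euclidean_space list \<Rightarrow> ('a \<Rightarrow> complex) \<Rightarrow> 'a \<Rightarrow> complex" where
  "pderivs [] f = f"
| "pderivs (b # bs) f = (\<lambda>z. frechet_derivative (pderivs bs f) (at z) b)"

definition smooth :: "('a::euclidean_space \<Rightarrow> complex) \<Rightarrow> bool" where
  "smooth f \<longleftrightarrow> (\<forall>bs\<in>lists Basis. \<forall>z. pderivs bs f differentiable (at z))"

definition schwartz :: "('a::euclidean_space \<Rightarrow> complex) set" where
  "schwartz = {f. smooth f \<and>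
     (\<forall>k::nat. \<forall>bs\<in>lists Basis. bdd_above (range (\<lambda>z. norm z ^ k * cmod (pderivs bs f z))))}"

definition schwartz_seminorm ::
    "nat \<Rightarrow> 'a::euclidean_space list \<Rightarrow> ('a \<Rightarrow> complex) \<Rightarrow> real" where
  "schwartz_seminorm k bs f = (SUP z. norm z ^ k * cmod (pderivs bs f z))"

text \<open>Distributions are functionals on functions, of which only the values on Schwartz functions
  are meaningful. Continuity for the Frechet topology of the Schwartz space is expressed by an
  estimate by finitely many seminorms.\<close>

definition tempered_distribution :: "(('a::euclidean_space \<Rightarrow> complex) \<Rightarrow> complex) \<Rightarrow> bool" where
  "tempered_distribution u \<longleftrightarrow>
     (\<forall>f\<in>schwartz. \<forall>g\<in>schwartz. u (\<lambda>z. f z + g z) = u f + u g) \<and>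
     (\<forall>f\<in>schwartz. \<forall>c. u (\<lambda>z. c * f z) = c * u f) \<and>
     (\<exists>(C::real) (M::nat). \<forall>f\<in>schwartz.
        cmod (u f) \<le> C * (\<Sum>k\<le>M. \<Sum>bs | set bs \<subseteq> Basis \<and> length bs \<le> M. schwartz_seminorm k bs f))"

definition function_distribution ::
    "('a::euclidean_space \<Rightarrow> complex) \<Rightarrow> ('a \<Rightarrow> complex) \<Rightarrow> complex" where
  "function_distribution a = (\<lambda>f. LINT z|lborel. a z * f z)"

text \<open>An operator from Schwartz functions to tempered distributions maps \<open>\<psi>\<close> to the functional
  \<open>A \<psi>\<close>. The continuity of \<open>\<psi> \<mapsto> A \<psi>\<close> is the one for the weak-* topology of the space of tempered
  distributions (for the strong topology one gets the same operators, by uniform boundedness).\<close>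

definition continuous_linear_operator ::
    "(('v::euclidean_space \<Rightarrow> complex) \<Rightarrow> ('v \<Rightarrow> complex) \<Rightarrow> complex) \<Rightarrow> bool" where
  "continuous_linear_operator A \<longleftrightarrow>
     (\<forall>\<psi>\<in>schwartz. tempered_distribution (A \<psi>)) \<and>
     (\<forall>\<phi>\<in>schwartz. tempered_distribution (\<lambda>\<psi>. A \<psi> \<phi>))"

section \<open>Symplectic maps and Weyl symbols\<close>

definition symplectic_form :: "'v::euclidean_space \<times> 'v \<Rightarrow> 'v \<times> 'v \<Rightarrow> real" where
  "symplectic_form = (\<lambda>(x, \<xi>) (x', \<xi>'). \<xi> \<bullet> x' - \<xi>' \<bullet> x)"

definition symplectic_group :: "('v::euclidean_space \<times> 'v \<Rightarrow> 'v \<times> 'v) set" where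
  "symplectic_group =
     {s. linear s \<and> bij s \<and> (\<forall>z w. symplectic_form (s z) (s w) = symplectic_form z w)}"

text \<open>Pairing the oscillatory integral for \<open>A \<psi>\<close> with a test function \<open>\<phi>(x')\<close> and substituting
  \<open>x' = x + t/2\<close>, \<open>y = x - t/2\<close> gives \<open>(2\<pi>)\<close> to the power \<open>-m\<close>, times the symbol applied to the
  following function of \<open>(x, \<xi>)\<close>.\<close>

definition weyl_kernel ::
    "('v::euclidean_space \<Rightarrow> complex) \<Rightarrow> ('v \<Rightarrow> complex) \<Rightarrow> 'v \<times> 'v \<Rightarrow> complex" where
  "weyl_kernel \<psi> \<phi> = (\<lambda>(x, \<xi>).
     LINT t|lborel. exp (\<i> * complex_of_real (t \<bullet> \<xi>)) *
       \<psi> (x - (1/2) *\<^sub>R t) * \<phi> (x + (1/2) *\<^sub>R t))"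

definition has_weyl_symbol ::
    "(('v::euclidean_space \<Rightarrow> complex) \<Rightarrow> ('v \<Rightarrow> complex) \<Rightarrow> complex) \<Rightarrow>
     (('v \<times> 'v \<Rightarrow> complex) \<Rightarrow> complex) \<Rightarrow> bool" where
  "has_weyl_symbol A u \<longleftrightarrow> tempered_distribution u \<and>
     (\<forall>\<psi>\<in>schwartz. \<forall>\<phi>\<in>schwartz.
        A \<psi> \<phi> = complex_of_real (1 / (2 * pi) ^ DIM('v)) * u (weyl_kernel \<psi> \<phi>))"

section \<open>Moyal product and Bopp operators\<close>

text \<open>With \<open>u = 2 (w - z)\<close> the Moyal product pairs with a test function \<open>\<Phi>\<close> as
  \<open>\<langle>a \<star> \<Psi>, \<Phi>\<rangle> = \<integral> a(w) K(w) dw\<close>, where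
  \<open>K(w) = (2\<pi>)\<^sup>-\<^sup>2\<^sup>n \<integral>\<integral> exp (- \<i> \<sigma>(v, w - z)) \<Psi>(z - v/2) \<Phi>(z) dz dv\<close>
  (absolutely convergent), the factor being \<open>(4\<pi>)\<^sup>-\<^sup>2\<^sup>n\<close> times the Jacobian \<open>2\<^sup>2\<^sup>n\<close>. This
  defines \<open>a \<star> \<Psi>\<close> for every tempered distribution \<open>a\<close>. The substitution \<open>v = 2t\<close>,
  \<open>z = X + t/2\<close>, \<open>w = (x - \<eta>/2, y + \<xi>/2)\<close> with \<open>X = (x, y)\<close> shows that \<open>\<Psi> \<mapsto> a \<star> \<Psi>\<close> is the
  Weyl operator with symbol \<open>a(x - \<eta>/2, y + \<xi>/2)\<close>.\<close>

definition moyal_kernel ::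
    "('v::euclidean_space \<times> 'v \<Rightarrow> complex) \<Rightarrow> ('v \<times> 'v \<Rightarrow> complex) \<Rightarrow> 'v \<times> 'v \<Rightarrow> complex" where
  "moyal_kernel \<Psi> \<Phi> w = complex_of_real (1 / (2 * pi) ^ (2 * DIM('v))) *
     (LINT (z, v)|lborel. exp (- \<i> * complex_of_real (symplectic_form v (w - z))) *
        \<Psi> (z - (1/2) *\<^sub>R v) * \<Phi> z)"

definition moyal_product ::
    "(('v::euclidean_space \<times> 'v \<Rightarrow> complex) \<Rightarrow> complex) \<Rightarrow> ('v \<times> 'v \<Rightarrow> complex) \<Rightarrow>
     ('v \<times> 'v \<Rightarrow> complex) \<Rightarrow> complex" where
  "moyal_product a \<Psi> = (\<lambda>\<Phi>. a (moyal_kernel \<Psi> \<Phi>))"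

definition bopp_operator ::
    "(('v::euclidean_space \<times> 'v \<Rightarrow> complex) \<Rightarrow> complex) \<Rightarrow> ('v \<times> 'v \<Rightarrow> complex) \<Rightarrow>
     ('v \<times> 'v \<Rightarrow> complex) \<Rightarrow> complex" where
  "bopp_operator a = (\<lambda>\<Psi>. moyal_product a \<Psi>)"

section \<open>Shubin classes\<close>

text \<open>To let the dimension vary, \<open>\<real>\<^sup>d\<close> is represented as the span of a set \<open>D\<close> of \<open>d\<close> standard basis
  vectors of the ambient space. A function on it is a function on the ambient space of which only
  the values on \<open>span D\<close> matter; composing with \<open>coord_proj D\<close> makes it a function of the
  coordinates in \<open>D\<close>.\<close>

definition coord_proj :: "'a::euclidean_space set \<Rightarrow> 'a \<Rightarrow> 'a" where
  "coord_proj D z = (\<Sum>b\<in>D. (z \<bullet> b) *\<^sub>R b)"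

definition shubin_class_on ::
    "'a::euclidean_space set \<Rightarrow> real \<Rightarrow> real \<Rightarrow> real \<Rightarrow> ('a \<Rightarrow> complex) set" where
  "shubin_class_on D \<rho> m1 m0 = {a. smooth (a \<circ> coord_proj D) \<and>
     (\<exists>R>0.
        (\<exists>C0>0. \<exists>C1>0. \<forall>z\<in>span D. norm z \<ge> R \<longrightarrow>
           C0 * norm z powr m0 \<le> cmod (a z) \<and> cmod (a z) \<le> C1 * norm z powr m1) \<and>
        (\<forall>bs\<in>lists D. \<exists>C\<ge>0. \<forall>z\<in>span D. norm z \<ge> R \<longrightarrow>
           cmod (pderivs bs (a \<circ> coord_proj D) z)
             \<le> C * cmod (a z) * norm z powr (- \<rho> * real (length bs))))}"

abbreviation shubin_class ::
    "real \<Rightarrow> real \<Rightarrow> real \<Rightarrow> ('a::euclidean_space \<Rightarrow> complex) set" where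
  "shubin_class \<equiv> shubin_class_on Basis"

lemma coord_proj_Basis: "coord_proj Basis z = z"
  by (simp add: coord_proj_def euclidean_representation)

lemma shubin_class_iff:
  "a \<in> shubin_class \<rho> m1 m0 \<longleftrightarrow> smooth a \<and>
     (\<exists>R>0.
        (\<exists>C0>0. \<exists>C1>0. \<forall>z. norm z \<ge> R \<longrightarrow>
           C0 * norm z powr m0 \<le> cmod (a z) \<and> cmod (a z) \<le> C1 * norm z powr m1) \<and>
        (\<forall>bs\<in>lists Basis. \<exists>C\<ge>0. \<forall>z. norm z \<ge> R \<longrightarrow>
           cmod (pderivs bs a z) \<le> C * cmod (a z) * norm z powr (- \<rho> * real (length bs))))"
proof -
  have "a \<circ> coord_proj Basis = a"
    by (simp add: fun_eq_iff coord_proj_Basis)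
  then show ?thesis
    by (simp add: shubin_class_on_def)
qed

section \<open>Symplectic dimensional extension\<close>

text \<open>The coordinates \<open>x \<in> \<real>\<^bsup>N-k\<^esup>\<close> of a point of the configuration space \<open>\<real>\<^sup>N\<close> are those
  belonging to a set \<open>B\<close> of \<open>N - k\<close> basis vectors, and \<open>y\<close> consists of the other ones.
  Then \<open>(x, \<xi>)\<close> ranges over the span of \<open>phase_coords B\<close>, a copy of \<open>\<real>\<^bsup>2(N-k)\<^esup>\<close>. Which
  coordinates are selected is irrelevant, since permutations of the coordinates, applied to
  positions and momenta simultaneously, are symplectic.\<close>

definition phase_coords :: "'v::euclidean_space set \<Rightarrow> ('v \<times> 'v) set" where
  "phase_coords B = (\<lambda>b. (b, 0)) ` B \<union> (\<lambda>b. (0, b)) ` B"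

definition tensor_one ::
    "'v::euclidean_space set \<Rightarrow> ('v \<times> 'v \<Rightarrow> complex) \<Rightarrow> 'v \<times> 'v \<Rightarrow> complex" where
  "tensor_one B a = (\<lambda>(p, q). a (coord_proj B p, coord_proj B q))"

definition symplectic_extension ::
    "'v::euclidean_space set \<Rightarrow> ('v \<times> 'v \<Rightarrow> 'v \<times> 'v) \<Rightarrow> ('v \<times> 'v \<Rightarrow> complex) \<Rightarrow>
     'v \<times> 'v \<Rightarrow> complex" where
  "symplectic_extension B s a = tensor_one B a \<circ> s"

definition extended_shubin_class ::
    "real \<Rightarrow> real \<Rightarrow> real \<Rightarrow>
     (('v::euclidean_space \<Rightarrow> complex) \<Rightarrow> ('v \<Rightarrow> complex) \<Rightarrow> complex) set" where
  "extended_shubin_class \<rho> m1 m0 = {A. continuous_linear_operator A \<and>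
     (\<exists>k B a s. k \<le> DIM('v) - 1 \<and> B \<subseteq> Basis \<and> card B = DIM('v) - k \<and>
        a \<in> shubin_class_on (phase_coords B) \<rho> m1 m0 \<and> s \<in> symplectic_group \<and>
        smooth (symplectic_extension B s a) \<and>
        has_weyl_symbol A (function_distribution (symplectic_extension B s a)))}"

end

theory Submission
  imports Defs "HOL-Probability.Sinc_Integral"
begin

text \<open>Write \<open>X = (x, y)\<close> and \<open>\<Xi> = (\<xi>, \<eta>)\<close> for position and momentum in the doubled phase space. The Bopp
  operator of \<open>a\<close> is the Weyl operator whose symbol is \<open>a\<close> evaluated at
  \<open>(x - \<eta>/2, y + \<xi>/2)\<close>. With the form \<open>\<xi> \<bullet> x' + \<eta> \<bullet> y' - \<xi>' \<bullet> x - \<eta>' \<bullet> y\<close> the coordinates \<open>x - \<eta>/2\<close> and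
  \<open>y + \<xi>/2\<close> are a canonically conjugate position and momentum, and \<open>x + \<eta>/2\<close>, \<open>\<xi>/2 - y\<close> are a second
  conjugate pair that commutes with the first. All four together form a linear symplectic map
  (\<open>bopp_symplectic_in_symplectic_group\<close>), so the Bopp symbol is the extension of \<open>a\<close> by half of
  the degrees of freedom: \<open>B\<close> consists of the basis vectors of the first factor, and the Shubin
  estimates for \<open>a\<close>, regarded as a function of the first mode, are those for \<open>a\<close> itself
  (\<open>shubin_class_first_mode\<close>).

  The analytic part is that the Bopp operator, defined through the Moyal kernel, has this Weyl
  symbol and is continuous. Both rest on one estimate (\<open>weyl_kernel_decay\<close>): the Weyl kernel
  \<open>W(X, \<Xi>)\<close> of two Schwartz functions decays faster than any power in \<open>X\<close> and \<open>\<Xi>\<close>, with a bound by the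
  product of Schwartz norms of the two functions. Decay in \<open>X\<close> comes from the decay of the
  functions, and decay in \<open>\<Xi>\<close> from integration by parts. Since a Shubin symbol grows at most
  polynomially, its pairing with \<open>W\<close> converges absolutely and is continuous in both functions
  (\<open>continuous_linear_operator_weyl\<close>). Absolute convergence also justifies Fubini's theorem:
  for fixed \<open>X\<close>, substituting \<open>w = (x - \<eta>/2, y + \<xi>/2)\<close> for \<open>\<Xi>\<close> turns the pairing of the Bopp symbol
  with \<open>W\<close> into the pairing of \<open>a\<close> with \<open>w \<mapsto> \<integral> W(X, \<Xi>(X, w)) dX\<close>, which is the Moyal kernel
  (\<open>moyal_kernel_eq_weyl_kernel\<close>, \<open>has_weyl_symbol_bopp_operator\<close>).\<close>

section \<open>Iterated derivatives of smooth functions\<close>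

lemma pderivs_append: "pderivs (bs @ cs) f = pderivs bs (pderivs cs f)"
  by (induction bs) auto

lemma smooth_differentiable:
  assumes "smooth f" "set bs \<subseteq> Basis"
  shows "pderivs bs f differentiable (at z)"
  using assms by (auto simp: smooth_def in_lists_conv_set)

lemma smooth_has_derivative:
  assumes "smooth f" "set bs \<subseteq> Basis"
  shows "(pderivs bs f has_derivative frechet_derivative (pderivs bs f) (at z)) (at z)"
  using smooth_differentiable[OF assms] by (simp add: frechet_derivative_works)

lemma smooth_pderivs:
  assumes "smooth f" "set cs \<subseteq> Basis"
  shows "smooth (pderivs cs f)"
  unfolding smooth_def
proof (intro ballI allI)
  fix bs :: "'a list" and z assume "bs \<in> lists Basis"
  then show "pderivs bs (pderivs cs f) differentiable (at z)"
    using smooth_differentiable[OF assms(1), of "bs @ cs" z] assms(2)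
    by (auto simp: pderivs_append)
qed

lemma smooth_continuous_on:
  assumes "smooth f"
  shows "continuous_on A f"
  using smooth_differentiable[OF assms, of "[]"]
  by (intro differentiable_imp_continuous_on) (auto simp: differentiable_on_def intro: differentiable_at_withinI)

lemma smooth_borel_measurable:
  assumes "smooth f"
  shows "f \<in> borel_measurable borel"
  using smooth_continuous_on[OF assms] by (rule borel_measurable_continuous_onI)

lemma pderivs_add:
  assumes "smooth f" "smooth g" "set bs \<subseteq> Basis"
  shows "pderivs bs (\<lambda>z. f z + g z) = (\<lambda>z. pderivs bs f z + pderivs bs g z)"
  using assms(3)
proof (induction bs)
  case (Cons b bs)
  have "((\<lambda>z. pderivs bs f z + pderivs bs g z) has_derivative
      (\<lambda>h. frechet_derivative (pderivs bs f) (at z) h + frechet_derivative (pderivs bs g) (at z) h)) (at z)" for z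
    using Cons.prems by (intro has_derivative_add smooth_has_derivative assms) auto
  from frechet_derivative_at[OF this, symmetric] Cons show ?case
    by simp
qed simp

lemma pderivs_cmult:
  assumes "smooth f" "set bs \<subseteq> Basis"
  shows "pderivs bs (\<lambda>z. c * f z) = (\<lambda>z. c * pderivs bs f z)"
  using assms(2)
proof (induction bs)
  case (Cons b bs)
  have "((\<lambda>z. c * pderivs bs f z) has_derivative
      (\<lambda>h. c * frechet_derivative (pderivs bs f) (at z) h)) (at z)" for z
    using Cons.prems by (intro has_derivative_mult_right smooth_has_derivative assms) auto
  from frechet_derivative_at[OF this, symmetric] Cons show ?case
    by simp
qed simp

lemma smooth_add: "smooth f \<Longrightarrow> smooth g \<Longrightarrow> smooth (\<lambda>z. f z + g z)"
  unfolding smooth_def[of "\<lambda>z. f z + g z"]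
  by (auto simp: pderivs_add in_lists_conv_set subset_iff intro!: differentiable_add smooth_differentiable)

lemma smooth_cmult: "smooth f \<Longrightarrow> smooth (\<lambda>z. c * f z)"
  unfolding smooth_def[of "\<lambda>z. c * f z"]
  by (auto simp: pderivs_cmult in_lists_conv_set subset_iff intro!: differentiable_mult smooth_differentiable)

text \<open>Reduces derivatives in the direction of an image \<open>L b\<close> to the partial derivatives occurring in
  \<open>pderivs\<close>.\<close>

lemma frechet_derivative_Basis_sum:
  fixes f :: "'a::euclidean_space \<Rightarrow> complex"
  assumes "f differentiable (at z)"
  shows "frechet_derivative f (at z) h = (\<Sum>b\<in>Basis. of_real (h \<bullet> b) * frechet_derivative f (at z) b)"
proof -
  interpret linear "frechet_derivative f (at z)"
    by (rule linear_frechet_derivative[OF assms])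
  have "frechet_derivative f (at z) h = frechet_derivative f (at z) (\<Sum>b\<in>Basis. (h \<bullet> b) *\<^sub>R b)"
    by (simp add: euclidean_representation)
  also have "\<dots> = (\<Sum>b\<in>Basis. of_real (h \<bullet> b) * frechet_derivative f (at z) b)"
    by (simp add: sum scale scaleR_conv_of_real)
  finally show ?thesis .
qed

lemma frechet_derivative_comp_linear:
  fixes f :: "'b::euclidean_space \<Rightarrow> complex" and L :: "'a::euclidean_space \<Rightarrow> 'b"
  assumes "f differentiable (at (L z))" "linear L"
  shows "frechet_derivative (\<lambda>z. f (L z)) (at z) h = frechet_derivative f (at (L z)) (L h)"
proof -
  have "((\<lambda>z. f (L z)) has_derivative (\<lambda>h. frechet_derivative f (at (L z)) (L h))) (at z)"
    using assms(1)
    by (intro has_derivative_compose[OF linear_imp_has_derivative[OF assms(2)]])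
       (simp add: frechet_derivative_works)
  from frechet_derivative_at[OF this, symmetric] show ?thesis by simp
qed

text \<open>For \<open>L\<close> sending the relevant basis vectors to basis vectors, the chain rule merely renames
  partial derivatives. This transports the Shubin estimates to more variables with unchanged constants.\<close>

lemma pderivs_comp_linear_Basis:
  fixes f :: "'b::euclidean_space \<Rightarrow> complex" and L :: "'a::euclidean_space \<Rightarrow> 'b"
  assumes "smooth f" "linear L" "L ` set bs \<subseteq> Basis"
  shows "pderivs bs (\<lambda>z. f (L z)) = (\<lambda>z. pderivs (map L bs) f (L z))"
  using assms(3)
proof (induction bs)
  case (Cons b bs)
  have *: "pderivs (map L bs) f differentiable (at (L z))" for z
    using Cons.prems by (intro smooth_differentiable assms) auto
  show ?case
    using Cons frechet_derivative_comp_linear[OF * assms(2)] by simp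
qed simp

text \<open>Each differentiation of \<open>f \<circ> L\<close> splits into partial derivatives of \<open>f\<close> of the same order, with
  constant coefficients.\<close>

lemma pderivs_comp_linear:
  fixes f :: "'b::euclidean_space \<Rightarrow> complex" and L :: "'a::euclidean_space \<Rightarrow> 'b"
  assumes "smooth f" "linear L"
  shows "\<exists>c::'b list \<Rightarrow> real. \<forall>z. pderivs bs (\<lambda>z. f (L z)) z =
    (\<Sum>cs | set cs \<subseteq> Basis \<and> length cs = length bs. of_real (c cs) * pderivs cs f (L z))"
proof (induction bs)
  case Nil
  have "{cs. set cs \<subseteq> (Basis::'b set) \<and> length cs = 0} = {[]}" by auto
  then show ?case by (auto intro!: exI[of _ "\<lambda>_. 1"])
next
  case (Cons b bs)
  let ?S = "\<lambda>n::nat. {cs. set cs \<subseteq> (Basis::'b set) \<and> length cs = n}"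
  from Cons obtain c :: "'b list \<Rightarrow> real" where c: "pderivs bs (\<lambda>z. f (L z)) =
      (\<lambda>z. \<Sum>cs\<in>?S (length bs). of_real (c cs) * pderivs cs f (L z))"
    by (auto simp: fun_eq_iff)
  \<comment> \<open>The new derivative becomes the head of the list; its coefficient is the component of \<open>L b\<close>.\<close>
  define c' where "c' = (\<lambda>cs. c (tl cs) * (L b \<bullet> hd cs))"
  have diff: "pderivs cs f differentiable (at (L z))" if "cs \<in> ?S n" for cs z n
    using that by (intro smooth_differentiable assms) auto
  have S_Suc: "?S (Suc n) = (\<lambda>(e, cs). e # cs) ` (Basis \<times> ?S n)" for n
    by (auto simp: length_Suc_conv image_iff) 
  show ?case
  proof (intro exI[of _ c'] allI)
    fix z
    have "((\<lambda>z. \<Sum>cs\<in>?S (length bs). of_real (c cs) * pderivs cs f (L z)) has_derivative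
       (\<lambda>h. \<Sum>cs\<in>?S (length bs). of_real (c cs) * frechet_derivative (pderivs cs f) (at (L z)) (L h))) (at z)"
      using diff
      by (intro has_derivative_sum has_derivative_mult_right
            has_derivative_compose[OF linear_imp_has_derivative[OF assms(2)]])
         (simp add: frechet_derivative_works)
    from frechet_derivative_at[OF this, symmetric]
    have "pderivs (b # bs) (\<lambda>z. f (L z)) z =
        (\<Sum>cs\<in>?S (length bs). of_real (c cs) * frechet_derivative (pderivs cs f) (at (L z)) (L b))"
      by (simp add: c)
    also have "\<dots> = (\<Sum>cs\<in>?S (length bs). \<Sum>e\<in>Basis. of_real (c' (e # cs)) * pderivs (e # cs) f (L z))"
      by (intro sum.cong refl, subst frechet_derivative_Basis_sum)
         (auto simp: c'_def sum_distrib_left mult_ac intro: diff)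
    also have "\<dots> = (\<Sum>(e, cs)\<in>Basis \<times> ?S (length bs). of_real (c' (e # cs)) * pderivs (e # cs) f (L z))"
      by (subst sum.swap) (simp add: sum.cartesian_product)
    also have "\<dots> = (\<Sum>cs\<in>?S (length (b # bs)). of_real (c' cs) * pderivs cs f (L z))"
      unfolding list.size(4) add_Suc_right add_0_right S_Suc
      by (subst sum.reindex) (auto simp: inj_on_def case_prod_unfold)
    finally show "pderivs (b # bs) (\<lambda>z. f (L z)) z = \<dots>" .
  qed
qed

lemma smooth_comp_linear:
  fixes f :: "'b::euclidean_space \<Rightarrow> complex" and L :: "'a::euclidean_space \<Rightarrow> 'b"
  assumes "smooth f" "linear L"
  shows "smooth (\<lambda>z. f (L z))"
  unfolding smooth_def
proof (intro ballI allI)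
  fix bs :: "'a list" and z
  obtain c :: "'b list \<Rightarrow> real" where c: "pderivs bs (\<lambda>z. f (L z)) =
      (\<lambda>z. \<Sum>cs | set cs \<subseteq> Basis \<and> length cs = length bs. of_real (c cs) * pderivs cs f (L z))"
    using pderivs_comp_linear[OF assms, of bs] by (auto simp: fun_eq_iff)
  have "(\<lambda>z. pderivs cs f (L z)) differentiable (at z)" if "set cs \<subseteq> Basis" for cs
    by (rule differentiable_compose[OF smooth_differentiable[OF assms(1) that]
          linear_imp_differentiable[OF assms(2)]])
  then show "pderivs bs (\<lambda>z. f (L z)) differentiable (at z)"
    unfolding c by (intro differentiable_sum differentiable_mult differentiable_const)
      (auto simp: finite_lists_length_eq)
qed

section \<open>Seminorms of Schwartz functions\<close>

text \<open>These sums of seminorms are the ones by which continuity of a tempered distribution is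
  expressed.\<close>

definition schwartz_norm :: "nat \<Rightarrow> ('a::euclidean_space \<Rightarrow> complex) \<Rightarrow> real" where
  "schwartz_norm M f =
     (\<Sum>k\<le>M. \<Sum>bs | set bs \<subseteq> Basis \<and> length bs \<le> M. schwartz_seminorm k bs f)"

lemma schwartz_smooth: "f \<in> schwartz \<Longrightarrow> smooth f"
  by (simp add: schwartz_def)

lemma schwartz_bdd:
  "f \<in> schwartz \<Longrightarrow> set bs \<subseteq> Basis \<Longrightarrow> bdd_above (range (\<lambda>z. norm z ^ k * cmod (pderivs bs f z)))"
  by (simp add: schwartz_def in_lists_conv_set subset_iff)

lemma schwartz_seminorm_bound:
  assumes "f \<in> schwartz" "set bs \<subseteq> Basis"
  shows "norm z ^ k * cmod (pderivs bs f z) \<le> schwartz_seminorm k bs f"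
  unfolding schwartz_seminorm_def by (intro cSUP_upper schwartz_bdd assms) auto

lemma schwartz_seminorm_nonneg:
  assumes "f \<in> schwartz" "set bs \<subseteq> Basis"
  shows "0 \<le> schwartz_seminorm k bs f"
  by (rule order_trans[OF _ schwartz_seminorm_bound[OF assms, of 0]]) simp

lemma schwartz_norm_nonneg: "f \<in> schwartz \<Longrightarrow> 0 \<le> schwartz_norm M f"
  unfolding schwartz_norm_def by (intro sum_nonneg schwartz_seminorm_nonneg) auto

lemma schwartz_seminorm_le_norm:
  assumes "f \<in> schwartz" "set bs \<subseteq> Basis" "length bs \<le> M" "k \<le> M"
  shows "schwartz_seminorm k bs f \<le> schwartz_norm M f"
proof -
  have "schwartz_seminorm k bs f \<le> (\<Sum>bs | set bs \<subseteq> Basis \<and> length bs \<le> M. schwartz_seminorm k bs f)"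
    using assms by (intro member_le_sum schwartz_seminorm_nonneg) (auto simp: finite_lists_length_le)
  also have "\<dots> \<le> schwartz_norm M f"
    unfolding schwartz_norm_def using assms
    by (intro member_le_sum[of k "{..M}" "\<lambda>k. \<Sum>bs | set bs \<subseteq> Basis \<and> length bs \<le> M. schwartz_seminorm k bs f"])
       (auto intro!: sum_nonneg schwartz_seminorm_nonneg)
  finally show ?thesis .
qed

lemma schwartz_norm_mono:
  assumes "f \<in> schwartz" "M \<le> N"
  shows "schwartz_norm M f \<le> schwartz_norm N f"
proof -
  have "schwartz_norm M f \<le> (\<Sum>k\<le>M. \<Sum>bs | set bs \<subseteq> Basis \<and> length bs \<le> N. schwartz_seminorm k bs f)"
    unfolding schwartz_norm_def using assms
    by (intro sum_mono sum_mono2) (auto simp: finite_lists_length_le schwartz_seminorm_nonneg)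
  also have "\<dots> \<le> schwartz_norm N f"
    unfolding schwartz_norm_def using assms
    by (intro sum_mono2) (auto intro!: sum_nonneg schwartz_seminorm_nonneg)
  finally show ?thesis .
qed

lemma schwartz_pderiv:
  assumes "f \<in> schwartz" "b \<in> Basis"
  shows "pderivs [b] f \<in> schwartz"
  unfolding schwartz_def
proof (intro CollectI conjI allI ballI)
  show "smooth (pderivs [b] f)"
    using assms by (intro smooth_pderivs schwartz_smooth) auto
  fix k and bs :: "'a list" assume "bs \<in> lists Basis"
  then have "set (bs @ [b]) \<subseteq> Basis" using assms by auto
  from schwartz_bdd[OF assms(1) this]
  show "bdd_above (range (\<lambda>z. norm z ^ k * cmod (pderivs bs (pderivs [b] f) z)))"
    unfolding pderivs_append .
qed

text \<open>Appending \<open>b\<close> to the multi-index maps the seminorms of the derivative injectively to seminorms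
  of \<open>f\<close> with one more differentiation.\<close>

lemma schwartz_norm_pderiv:
  assumes "f \<in> schwartz" "b \<in> Basis"
  shows "schwartz_norm M (pderivs [b] f) \<le> schwartz_norm (Suc M) f"
proof -
  have eq: "schwartz_seminorm k bs (pderivs [b] f) = schwartz_seminorm k (bs @ [b]) f" for k bs
    by (simp add: schwartz_seminorm_def pderivs_append del: pderivs.simps(2))
  have "schwartz_norm M (pderivs [b] f)
      = (\<Sum>k\<le>M. \<Sum>bs\<in>(\<lambda>bs. bs @ [b]) ` {bs. set bs \<subseteq> Basis \<and> length bs \<le> M}. schwartz_seminorm k bs f)"
    unfolding schwartz_norm_def eq by (subst sum.reindex) (auto simp: inj_on_def)
  also have "\<dots> \<le> (\<Sum>k\<le>M. \<Sum>bs | set bs \<subseteq> Basis \<and> length bs \<le> Suc M. schwartz_seminorm k bs f)"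
    using assms(2) by (intro sum_mono sum_mono2)
      (auto simp: finite_lists_length_le intro!: schwartz_seminorm_nonneg[OF assms(1)])
  also have "\<dots> \<le> schwartz_norm (Suc M) f"
    unfolding schwartz_norm_def using assms
    by (intro sum_mono2) (auto intro!: sum_nonneg schwartz_seminorm_nonneg)
  finally show ?thesis .
qed

lemma one_plus_power_le: "(1 + x) ^ k \<le> 2 ^ k * (1 + x ^ k)" if "0 \<le> x" for x :: real
proof (cases "x \<le> 1")
  case True
  then have "(1 + x) ^ k \<le> 2 ^ k" using that by (intro power_mono) auto
  also have "\<dots> \<le> 2 ^ k * (1 + x ^ k)" using that by simp
  finally show ?thesis .
next
  case False
  then have "(1 + x) ^ k \<le> (2 * x) ^ k" using that by (intro power_mono) auto
  also have "\<dots> \<le> 2 ^ k * (1 + x ^ k)" using that by (simp add: power_mult_distrib)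
  finally show ?thesis .
qed

lemma schwartz_decay:
  assumes "f \<in> schwartz" "set bs \<subseteq> Basis" "length bs \<le> M"
  shows "(1 + norm z) ^ M * cmod (pderivs bs f z) \<le> 2 ^ Suc M * schwartz_norm M f"
proof -
  have "(1 + norm z) ^ M * cmod (pderivs bs f z)
      \<le> 2 ^ M * (1 + norm z ^ M) * cmod (pderivs bs f z)"
    by (intro mult_right_mono one_plus_power_le) auto
  also have "\<dots> = 2 ^ M * (norm z ^ 0 * cmod (pderivs bs f z) + norm z ^ M * cmod (pderivs bs f z))"
    by (simp add: algebra_simps)
  also have "\<dots> \<le> 2 ^ M * (schwartz_norm M f + schwartz_norm M f)"
    using assms
    by (intro mult_left_mono add_mono order_trans[OF schwartz_seminorm_bound schwartz_seminorm_le_norm]) auto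
  finally show ?thesis by simp
qed

lemma schwartz_add:
  assumes "f \<in> schwartz" "g \<in> schwartz"
  shows "(\<lambda>z. f z + g z) \<in> schwartz"
  unfolding schwartz_def
proof (intro CollectI conjI allI ballI)
  show "smooth (\<lambda>z. f z + g z)" using assms by (intro smooth_add schwartz_smooth)
  fix k and bs :: "'a list" assume "bs \<in> lists Basis"
  then have bs: "set bs \<subseteq> Basis" by auto
  show "bdd_above (range (\<lambda>z. norm z ^ k * cmod (pderivs bs (\<lambda>z. f z + g z) z)))"
  proof (rule bdd_aboveI2)
    fix z
    have "norm z ^ k * cmod (pderivs bs (\<lambda>z. f z + g z) z)
       \<le> norm z ^ k * (cmod (pderivs bs f z) + cmod (pderivs bs g z))"
      using assms bs by (intro mult_left_mono) (auto simp: pderivs_add schwartz_smooth norm_triangle_ineq)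
    also have "\<dots> \<le> schwartz_seminorm k bs f + schwartz_seminorm k bs g"
      unfolding distrib_left by (intro add_mono schwartz_seminorm_bound assms bs)
    finally show "norm z ^ k * cmod (pderivs bs (\<lambda>z. f z + g z) z)
      \<le> schwartz_seminorm k bs f + schwartz_seminorm k bs g" .
  qed
qed

lemma schwartz_cmult:
  assumes "f \<in> schwartz"
  shows "(\<lambda>z. c * f z) \<in> schwartz"
  unfolding schwartz_def
proof (intro CollectI conjI allI ballI)
  show "smooth (\<lambda>z. c * f z)" using assms by (intro smooth_cmult schwartz_smooth)
  fix k and bs :: "'a list" assume "bs \<in> lists Basis"
  then have bs: "set bs \<subseteq> Basis" by auto
  show "bdd_above (range (\<lambda>z. norm z ^ k * cmod (pderivs bs (\<lambda>z. c * f z) z)))"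
  proof (rule bdd_aboveI2)
    fix z
    have "norm z ^ k * cmod (pderivs bs (\<lambda>z. c * f z) z) = cmod c * (norm z ^ k * cmod (pderivs bs f z))"
      using assms bs by (simp add: pderivs_cmult schwartz_smooth norm_mult)
    also have "\<dots> \<le> cmod c * schwartz_seminorm k bs f"
      by (intro mult_left_mono schwartz_seminorm_bound assms bs) auto
    finally show "norm z ^ k * cmod (pderivs bs (\<lambda>z. c * f z) z) \<le> cmod c * schwartz_seminorm k bs f" .
  qed
qed

section \<open>Integrals of rapidly decaying functions\<close>

lemma lborel_integral_affine:
  fixes f :: "'a::euclidean_space \<Rightarrow> complex"
  assumes "f \<in> borel_measurable borel" "c \<noteq> 0"
  shows "(LINT x|lborel. f x) = \<bar>c\<bar> ^ DIM('a) *\<^sub>R (LINT x|lborel. f (t + c *\<^sub>R x))"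
proof -
  have [measurable]: "f \<in> borel_measurable borel" by fact
  show ?thesis
    by (subst lborel_affine[OF assms(2), of t])
       (simp add: integral_density integral_distr)
qed

text \<open>The exponent is twice the dimension so that the function is dominated by the product over the
  coordinates of the integrable functions \<open>t \<mapsto> 1 / (1 + t\<^sup>2)\<close>.\<close>

lemma integrable_inverse_one_plus_norm:
  "integrable lborel (\<lambda>z::'a::euclidean_space. 1 / (1 + norm z) ^ (2 * DIM('a)))"
proof (rule Bochner_Integration.integrable_bound)
  interpret product_sigma_finite "\<lambda>_::'a. lborel::real measure" ..
  have "integrable lborel (\<lambda>x::real. inverse (1 + x\<^sup>2))"
    using integrable_inverse_1_plus_square by (simp add: set_integrable_def)
  then have "integrable (\<Pi>\<^sub>M b\<in>(Basis::'a set). (lborel :: real measure)) (\<lambda>x. \<Prod>b\<in>Basis. inverse (1 + (x b)\<^sup>2))"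
    using product_integrable_prod[of "Basis::'a set" "\<lambda>_ x. inverse (1 + x\<^sup>2)"] by simp
  then have "integrable (\<Pi>\<^sub>M b\<in>(Basis::'a set). (lborel :: real measure))
      (\<lambda>x. \<Prod>b\<in>Basis. inverse (1 + ((\<Sum>b\<in>Basis. x b *\<^sub>R b) \<bullet> b)\<^sup>2))"
    by simp
  then have "integrable (distr (\<Pi>\<^sub>M b\<in>(Basis::'a set). (lborel :: real measure)) borel
      (\<lambda>f. \<Sum>b\<in>Basis. f b *\<^sub>R b)) (\<lambda>z::'a. \<Prod>b\<in>Basis. inverse (1 + (z \<bullet> b)\<^sup>2))"
    by (subst integrable_distr_eq) simp_all
  then show "integrable lborel (\<lambda>z::'a. \<Prod>b\<in>Basis. inverse (1 + (z \<bullet> b)\<^sup>2))"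
    by (simp only: lborel_eq[where 'a = 'a])
  show "AE z::'a in lborel. norm (1 / (1 + norm z) ^ (2 * DIM('a))) \<le> norm (\<Prod>b\<in>Basis. inverse (1 + (z \<bullet> b)\<^sup>2))"
  proof (rule AE_I2)
    fix z :: 'a
    have "(\<Prod>b\<in>Basis. 1 + (z \<bullet> b)\<^sup>2) \<le> (\<Prod>b\<in>(Basis::'a set). (1 + norm z)\<^sup>2)"
    proof (intro prod_mono conjI)
      fix b :: 'a assume "b \<in> Basis"
      then have "(z \<bullet> b)\<^sup>2 \<le> (norm z)\<^sup>2" using Basis_le_norm[of b z] by (metis abs_ge_zero power2_abs power_mono)
      then show "1 + (z \<bullet> b)\<^sup>2 \<le> (1 + norm z)\<^sup>2"
        by (simp add: power2_sum add_increasing2)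
    qed simp
    then have *: "(\<Prod>b\<in>Basis. 1 + (z \<bullet> b)\<^sup>2) \<le> (1 + norm z) ^ (2 * DIM('a))"
      by (simp add: power_mult)
    have "0 < (\<Prod>b\<in>Basis. 1 + (z \<bullet> b)\<^sup>2)" by (intro prod_pos) (auto simp: add_pos_nonneg)
    with * have "1 / (1 + norm z) ^ (2 * DIM('a)) \<le> 1 / (\<Prod>b\<in>Basis. 1 + (z \<bullet> b)\<^sup>2)"
      by (intro divide_left_mono mult_pos_pos) (auto intro: add_pos_nonneg)
    also have "\<dots> = (\<Prod>b\<in>Basis. inverse (1 + (z \<bullet> b)\<^sup>2))"
      by (simp add: inverse_eq_divide prod_dividef)
    finally show "norm (1 / (1 + norm z) ^ (2 * DIM('a))) \<le> norm (\<Prod>b\<in>Basis. inverse (1 + (z \<bullet> b)\<^sup>2))"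
      by simp
  qed
qed simp

lemma integrable_decay:
  fixes f :: "'a::euclidean_space \<Rightarrow> complex"
  assumes "f \<in> borel_measurable borel" "\<And>z. (1 + norm z) ^ (2 * DIM('a)) * cmod (f z) \<le> C"
  shows "integrable lborel f"
    and "(LINT z|lborel. cmod (f z)) \<le> C * (LINT z|lborel. 1 / (1 + norm (z::'a)) ^ (2 * DIM('a)))"
proof -
  have *: "cmod (f z) \<le> C * (1 / (1 + norm z) ^ (2 * DIM('a)))" for z
    using assms(2)[of z] by (simp add: pos_le_divide_eq add_pos_nonneg mult.commute)
  have i: "integrable lborel (\<lambda>z::'a. C * (1 / (1 + norm z) ^ (2 * DIM('a))))"
    by (intro integrable_mult_right integrable_inverse_one_plus_norm)
  show "integrable lborel f"
    using assms(1) by (intro Bochner_Integration.integrable_bound[OF i] AE_I2 order_trans[OF *])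
      (auto simp: abs_mult intro!: divide_right_mono)
  then have "(LINT z|lborel. cmod (f z)) \<le> (LINT z|lborel. C * (1 / (1 + norm (z::'a)) ^ (2 * DIM('a))))"
    by (intro integral_mono * i) simp
  also have "\<dots> = C * (LINT z|lborel. 1 / (1 + norm (z::'a)) ^ (2 * DIM('a)))"
    by (rule integral_mult_right_zero)
  finally show "(LINT z|lborel. cmod (f z)) \<le> C * (LINT z|lborel. 1 / (1 + norm (z::'a)) ^ (2 * DIM('a)))" .
qed

text \<open>Integration by parts without slicing: the integral of the difference quotient
  \<open>(F (t + h b) - F t) / h\<close> vanishes by translation invariance, and the quotients converge to the
  derivative under domination, which the mean value inequality provides.\<close>

lemma integral_directional_derivative_zero:
  fixes F :: "'a::euclidean_space \<Rightarrow> complex"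
  assumes deriv: "\<And>t. (F has_derivative F' t) (at t)"
    and meas: "(\<lambda>t. F' t b) \<in> borel_measurable borel"
    and decay: "\<And>t. (1 + norm t) ^ (2 * DIM('a)) * cmod (F t) \<le> C"
      "\<And>t. (1 + norm t) ^ (2 * DIM('a)) * cmod (F' t b) \<le> C"
    and b: "norm b \<le> 1"
  shows "(LINT t|lborel. F' t b) = 0"
proof -
  define h where "h = (\<lambda>n::nat. 1 / real (Suc n))"
  define N where "N = 2 * DIM('a)"
  have h: "0 < h n" "h n \<le> 1" for n by (auto simp: h_def)
  have h_lim: "h \<longlonglongrightarrow> 0" unfolding h_def by (rule LIMSEQ_Suc[OF lim_1_over_n])
  have F_meas [measurable]: "F \<in> borel_measurable borel"
    using deriv by (intro borel_measurable_continuous_onI continuous_at_imp_continuous_on)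
      (auto intro: has_derivative_continuous)
  have F_int: "integrable lborel F" by (rule integrable_decay[OF F_meas decay(1)])
  have C: "0 \<le> C" using order_trans[OF norm_ge_zero, of "F 0" C] decay(1)[of 0] by simp
  let ?s = "\<lambda>n t. (F (t + h n *\<^sub>R b) - F t) / h n"
  have shift: "integrable lborel (\<lambda>t. F (t + h n *\<^sub>R b))"
    "(LINT t|lborel. F (t + h n *\<^sub>R b)) = (LINT t|lborel. F t)" for n
  proof -
    show eq: "(LINT t|lborel. F (t + h n *\<^sub>R b)) = (LINT t|lborel. F t)"
      using lborel_integral_affine[OF F_meas, of 1 "h n *\<^sub>R b"] by (simp add: add.commute)
    have "integrable (distr lborel borel (\<lambda>t. h n *\<^sub>R b + t)) F"
      using F_int lborel_affine[of 1 "h n *\<^sub>R b"] by (simp add: density_1)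
    then show "integrable lborel (\<lambda>t. F (t + h n *\<^sub>R b))"
      by (subst (asm) integrable_distr_eq) (auto simp: add.commute)
  qed
  have zero: "(LINT t|lborel. ?s n t) = 0" for n
    using shift F_int by simp
  have "(\<lambda>n. LINT t|lborel. ?s n t) \<longlonglongrightarrow> (LINT t|lborel. F' t b)"
  proof (rule integral_dominated_convergence)
    show "integrable lborel (\<lambda>t::'a. 2 ^ N * C * (1 / (1 + norm t) ^ N))"
      unfolding N_def by (intro integrable_mult_right integrable_inverse_one_plus_norm)
    show "AE t in lborel. (\<lambda>n. ?s n t) \<longlonglongrightarrow> F' t b"
    proof (rule AE_I2)
      fix t
      have "((\<lambda>x. F (t + x *\<^sub>R b)) has_derivative (\<lambda>x. F' t (x *\<^sub>R b))) (at 0)"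
        by (rule has_derivative_compose[where g = F]) (auto intro!: derivative_eq_intros deriv)
      then have "((\<lambda>x. norm ((F (t + x *\<^sub>R b) - F t - x *\<^sub>R F' t b)) / norm x) \<longlongrightarrow> 0) (at 0)"
        by (simp add: has_derivative_iff_norm linear_simps(5)[OF has_derivative_bounded_linear[OF deriv]])
      then have "((\<lambda>x. norm ((F (t + x *\<^sub>R b) - F t) /\<^sub>R x - F' t b)) \<longlongrightarrow> 0) (at 0)"
      proof (rule Lim_transform_eventually, unfold eventually_at_filter, intro always_eventually allI impI)
        fix x :: real assume "x \<noteq> 0"
        then have "(F (t + x *\<^sub>R b) - F t) /\<^sub>R x - F' t b = (F (t + x *\<^sub>R b) - F t - x *\<^sub>R F' t b) /\<^sub>R x"
          by (simp add: scaleR_diff_right)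
        then show "norm (F (t + x *\<^sub>R b) - F t - x *\<^sub>R F' t b) / norm x = norm ((F (t + x *\<^sub>R b) - F t) /\<^sub>R x - F' t b)"
          by (simp only: norm_scaleR) (simp add: divide_inverse mult.commute)
      qed
      then have "((\<lambda>x. (F (t + x *\<^sub>R b) - F t) /\<^sub>R x) \<longlongrightarrow> F' t b) (at 0)"
        by (rule LIM_zero_cancel[OF tendsto_norm_zero_cancel])
      moreover have "filterlim h (at 0) sequentially"
        using h_lim h by (auto simp: filterlim_at less_imp_neq[symmetric])
      ultimately have "(\<lambda>n. (F (t + h n *\<^sub>R b) - F t) /\<^sub>R h n) \<longlonglongrightarrow> F' t b"
        by (rule filterlim_compose)
      then show "(\<lambda>n. ?s n t) \<longlonglongrightarrow> F' t b"
        by (simp add: scaleR_conv_of_real divide_inverse mult.commute)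
    qed
    show "AE t in lborel. norm (?s n t) \<le> 2 ^ N * C * (1 / (1 + norm t) ^ N)" for n
    proof (rule AE_I2)
      fix t
      \<comment> \<open>A shift by at most one changes \<open>1 + norm t\<close> by at most the factor two.\<close>
      have bound: "norm (F' (t + x *\<^sub>R b) b) \<le> 2 ^ N * C * (1 / (1 + norm t) ^ N)" if "x \<in> {0..h n}" for x
      proof -
        have "norm (x *\<^sub>R b) \<le> 1" using that h(2)[of n] b by (auto intro: mult_le_one)
        moreover have *: "1 + a \<le> 2 * (1 + n)" if "a \<le> n + 1" "0 \<le> n" for a n :: real
          using that by simp
        moreover have "norm t \<le> norm (t + x *\<^sub>R b) + norm (x *\<^sub>R b)"
          using norm_triangle_ineq4[of "t + x *\<^sub>R b" "x *\<^sub>R b"] by simp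
        ultimately have "norm t \<le> norm (t + x *\<^sub>R b) + 1"
          by (metis add_left_mono order_trans)
        then have "1 + norm t \<le> 2 * (1 + norm (t + x *\<^sub>R b))"
          using *[OF _ norm_ge_zero] by blast
        then have "(1 + norm t) ^ N \<le> (2 * (1 + norm (t + x *\<^sub>R b))) ^ N"
          by (intro power_mono) auto
        then have "(1 + norm t) ^ N * norm (F' (t + x *\<^sub>R b) b)
            \<le> 2 ^ N * ((1 + norm (t + x *\<^sub>R b)) ^ N * norm (F' (t + x *\<^sub>R b) b))"
          unfolding power_mult_distrib mult.assoc[symmetric] by (rule mult_right_mono[OF _ norm_ge_zero])
        also have "\<dots> \<le> 2 ^ N * C"
          using decay(2)[of "t + x *\<^sub>R b"] by (simp add: N_def)
        finally show ?thesis
          by (simp add: pos_le_divide_eq add_pos_nonneg mult.commute)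
      qed
      have "norm (F (t + h n *\<^sub>R b) - F (t + 0 *\<^sub>R b)) \<le> 2 ^ N * C * (1 / (1 + norm t) ^ N) * norm (h n - 0)"
      proof (rule differentiable_bound[where S = "{0..h n}" and f = "\<lambda>x. F (t + x *\<^sub>R b)"])
        fix x assume x: "x \<in> {0..h n}"
        show deriv': "((\<lambda>x. F (t + x *\<^sub>R b)) has_derivative (\<lambda>y. F' (t + x *\<^sub>R b) (y *\<^sub>R b))) (at x within {0..h n})"
          by (rule has_derivative_compose[where g = F]) (auto intro!: derivative_eq_intros deriv)
        have scale: "norm (F' (t + x *\<^sub>R b) (y *\<^sub>R b)) = norm (F' (t + x *\<^sub>R b) b) * norm y" for y
          by (simp add: linear_simps(5)[OF has_derivative_bounded_linear[OF deriv]])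
        have "0 \<le> 2 ^ N * C * (1 / (1 + norm t) ^ N)"
          using C by simp
        then show "onorm (\<lambda>y. F' (t + x *\<^sub>R b) (y *\<^sub>R b)) \<le> 2 ^ N * C * (1 / (1 + norm t) ^ N)"
          by (intro onorm_bound) (simp_all only: scale mult_right_mono[OF bound[OF x] norm_ge_zero])
      qed (use h in \<open>auto simp: less_imp_le\<close>)
      then show "norm (?s n t) \<le> 2 ^ N * C * (1 / (1 + norm t) ^ N)"
        using h[of n] by (simp add: norm_divide pos_divide_le_eq)
    qed
  qed (use meas in auto)
  then show ?thesis
    unfolding zero by (simp add: LIMSEQ_const_iff)
qed

section \<open>Decay of the Weyl kernel\<close>

definition weyl_integrand ::
    "('v::euclidean_space \<Rightarrow> complex) \<Rightarrow> ('v \<Rightarrow> complex) \<Rightarrow> 'v \<Rightarrow> 'v \<Rightarrow> 'v \<Rightarrow> complex" where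
  "weyl_integrand \<psi> \<phi> x \<xi> t =
     exp (\<i> * complex_of_real (t \<bullet> \<xi>)) * \<psi> (x - (1/2) *\<^sub>R t) * \<phi> (x + (1/2) *\<^sub>R t)"

lemma weyl_kernel_eq: "weyl_kernel \<psi> \<phi> (x, \<xi>) = (LINT t|lborel. weyl_integrand \<psi> \<phi> x \<xi> t)"
  by (simp add: weyl_kernel_def weyl_integrand_def)

lemma cmod_weyl_integrand:
  "cmod (weyl_integrand \<psi> \<phi> x \<xi> t) = cmod (\<psi> (x - (1/2) *\<^sub>R t)) * cmod (\<phi> (x + (1/2) *\<^sub>R t))"
  by (simp add: weyl_integrand_def norm_mult)

lemma weyl_integrand_measurable:
  assumes "\<psi> \<in> schwartz" "\<phi> \<in> schwartz"
  shows "(\<lambda>(x, \<xi>, t). weyl_integrand \<psi> \<phi> x \<xi> t) \<in> borel_measurable borel"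
proof (rule borel_measurable_continuous_onI)
  have "continuous_on UNIV \<psi>" "continuous_on UNIV \<phi>"
    using assms by (auto intro!: smooth_continuous_on schwartz_smooth)
  then have *: "continuous_on UNIV (\<lambda>z. \<psi> (f z))" "continuous_on UNIV (\<lambda>z. \<phi> (f z))"
    if "continuous_on UNIV f" for f :: "'a \<times> 'a \<times> 'a \<Rightarrow> 'a"
    using that by (auto intro: continuous_on_compose2)
  show "continuous_on UNIV (\<lambda>(x, \<xi>, t). weyl_integrand \<psi> \<phi> x \<xi> t)"
    unfolding weyl_integrand_def case_prod_unfold by (intro continuous_intros *)
qed

lemma weyl_integrand_compose_measurable [measurable (raw)]:
  assumes "\<psi> \<in> schwartz" "\<phi> \<in> schwartz"
    and "f \<in> borel_measurable M" "g \<in> borel_measurable M" "h \<in> borel_measurable M"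
  shows "(\<lambda>z. weyl_integrand \<psi> \<phi> (f z) (g z) (h z)) \<in> borel_measurable M"
proof -
  have "(\<lambda>z. (f z, g z, h z)) \<in> M \<rightarrow>\<^sub>M borel"
    using assms(3-) unfolding borel_prod[symmetric] by measurable
  from measurable_compose[OF this weyl_integrand_measurable[OF assms(1,2)]] show ?thesis
    by simp
qed

text \<open>The arguments \<open>u = x - t/2\<close> and \<open>v = x + t/2\<close> of the two functions control both \<open>x = (u + v)/2\<close> and
  \<open>t = v - u\<close>, so decay in \<open>u\<close> and \<open>v\<close> can be traded for decay in \<open>x\<close> and \<open>t\<close>.\<close>

lemma position_difference_weight_le:
  fixes x t :: "'a::real_normed_vector"
  shows "(1 + norm x) ^ j * (1 + norm t) ^ l \<le>
    ((1 + norm (x - (1/2) *\<^sub>R t)) * (1 + norm (x + (1/2) *\<^sub>R t))) ^ (j + l)"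
proof -
  let ?u = "x - (1/2) *\<^sub>R t" and ?v = "x + (1/2) *\<^sub>R t"
  have "t = ?v - ?u" by (simp add: scaleR_add_left[symmetric])
  then have t: "norm t \<le> norm ?u + norm ?v"
    using norm_triangle_ineq4[of ?v ?u] by simp
  have "?u + ?v = 2 *\<^sub>R x" by (simp add: scaleR_2)
  then have "2 * norm x = norm (?u + ?v)" by simp
  then have x: "norm x \<le> norm ?u + norm ?v"
    using norm_triangle_ineq[of ?u ?v] norm_ge_zero[of x] by linarith
  let ?p = "(1 + norm ?u) * (1 + norm ?v)"
  have p: "1 + norm ?u + norm ?v \<le> ?p" by (simp add: algebra_simps)
  have "(1 + norm x) ^ j * (1 + norm t) ^ l \<le> ?p ^ j * ?p ^ l"
    using x t p by (intro mult_mono power_mono) auto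
  then show ?thesis by (simp add: power_add)
qed

lemma weyl_integrand_decay:
  fixes \<psi> \<phi> :: "'v::euclidean_space \<Rightarrow> complex"
  assumes "\<psi> \<in> schwartz" "\<phi> \<in> schwartz"
  shows "(1 + norm x) ^ j * (1 + norm t) ^ l * cmod (weyl_integrand \<psi> \<phi> x \<xi> t)
    \<le> 4 ^ Suc (j + l) * (schwartz_norm (j + l) \<psi> * schwartz_norm (j + l) \<phi>)"
proof -
  let ?u = "x - (1/2) *\<^sub>R t" and ?v = "x + (1/2) *\<^sub>R t" and ?M = "j + l"
  have "(1 + norm x) ^ j * (1 + norm t) ^ l * cmod (weyl_integrand \<psi> \<phi> x \<xi> t)
    \<le> ((1 + norm ?u) * (1 + norm ?v)) ^ ?M * (cmod (\<psi> ?u) * cmod (\<phi> ?v))"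
    unfolding cmod_weyl_integrand by (intro mult_right_mono position_difference_weight_le) simp
  also have "\<dots> = ((1 + norm ?u) ^ ?M * cmod (\<psi> ?u)) * ((1 + norm ?v) ^ ?M * cmod (\<phi> ?v))"
    by (simp only: power_mult_distrib mult_ac)
  also have "\<dots> \<le> (2 ^ Suc ?M * schwartz_norm ?M \<psi>) * (2 ^ Suc ?M * schwartz_norm ?M \<phi>)"
    using schwartz_decay[OF assms(1), of "[]" ?M ?u] schwartz_decay[OF assms(2), of "[]" ?M ?v]
    by (intro mult_mono[of _ "2 ^ Suc ?M * _"])
       (simp_all add: schwartz_norm_nonneg assms del: power_Suc)
  also have "\<dots> = (2 * 2) ^ Suc ?M * (schwartz_norm ?M \<psi> * schwartz_norm ?M \<phi>)"
    by (simp only: power_mult_distrib mult_ac)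
  finally show ?thesis by simp
qed

lemma weyl_integrand_decay_t:
  fixes \<psi> \<phi> :: "'v::euclidean_space \<Rightarrow> complex"
  assumes "\<psi> \<in> schwartz" "\<phi> \<in> schwartz"
  shows "(1 + norm t) ^ l * cmod (weyl_integrand \<psi> \<phi> x \<xi> t)
    \<le> 4 ^ Suc l * (schwartz_norm l \<psi> * schwartz_norm l \<phi>)"
  using weyl_integrand_decay[OF assms, of x 0 t l \<xi>] by simp

lemma integrable_weyl_integrand:
  fixes \<psi> \<phi> :: "'v::euclidean_space \<Rightarrow> complex"
  assumes "\<psi> \<in> schwartz" "\<phi> \<in> schwartz"
  shows "integrable lborel (weyl_integrand \<psi> \<phi> x \<xi>)"
  by (rule integrable_decay(1)[OF _ weyl_integrand_decay_t[OF assms]])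
     (use assms in measurable)

lemma weyl_kernel_decay_position:
  fixes \<psi> \<phi> :: "'v::euclidean_space \<Rightarrow> complex" and j
  defines "M \<equiv> j + 2 * DIM('v)"
  assumes "\<psi> \<in> schwartz" "\<phi> \<in> schwartz"
  shows "(1 + norm x) ^ j * cmod (weyl_kernel \<psi> \<phi> (x, \<xi>)) \<le>
    4 ^ Suc M * (LINT z|lborel. 1 / (1 + norm (z::'v)) ^ (2 * DIM('v))) *
      (schwartz_norm M \<psi> * schwartz_norm M \<phi>)"
proof -
  let ?f = "\<lambda>t. (1 + norm x) ^ j *\<^sub>R weyl_integrand \<psi> \<phi> x \<xi> t"
  have "(1 + norm x) ^ j * cmod (weyl_kernel \<psi> \<phi> (x, \<xi>)) = cmod (LINT t|lborel. ?f t)"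
    by (simp add: weyl_kernel_eq)
  also have "\<dots> \<le> (LINT t|lborel. cmod (?f t))" by (rule integral_norm_bound)
  also have "\<dots> \<le> 4 ^ Suc M * (schwartz_norm M \<psi> * schwartz_norm M \<phi>) *
      (LINT z|lborel. 1 / (1 + norm (z::'v)) ^ (2 * DIM('v)))"
  proof (rule integrable_decay(2))
    show "?f \<in> borel_measurable borel" using assms(2,3) by measurable
    show "(1 + norm t) ^ (2 * DIM('v)) * cmod (?f t) \<le> 4 ^ Suc M * (schwartz_norm M \<psi> * schwartz_norm M \<phi>)" for t
      using weyl_integrand_decay[OF assms(2,3), of x j t "2 * DIM('v)" \<xi>]
      by (simp add: M_def mult_ac)
  qed
  finally show ?thesis by (simp add: mult_ac)
qed

text \<open>The integral of the \<open>t\<close>-derivative of the integrand in the direction \<open>b\<close> vanishes. The derivative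
  of the exponential contributes the factor \<open>\<i> (\<xi> \<bullet> b)\<close>, and those of \<open>\<psi> (x - t/2)\<close> and
  \<open>\<phi> (x + t/2)\<close> contribute the two terms on the right.\<close>

lemma weyl_kernel_pderiv:
  fixes \<psi> \<phi> :: "'v::euclidean_space \<Rightarrow> complex"
  assumes "\<psi> \<in> schwartz" "\<phi> \<in> schwartz" "b \<in> Basis"
  shows "\<i> * of_real (\<xi> \<bullet> b) * weyl_kernel \<psi> \<phi> (x, \<xi>) =
    (weyl_kernel (pderivs [b] \<psi>) \<phi> (x, \<xi>) - weyl_kernel \<psi> (pderivs [b] \<phi>) (x, \<xi>)) / 2"
proof -
  let ?D = "\<lambda>f. pderivs [b] f" and ?N = "2 * DIM('v)"
  let ?F = "weyl_integrand \<psi> \<phi> x \<xi>"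
  let ?\<psi>' = "\<lambda>t. frechet_derivative \<psi> (at (x - (1/2) *\<^sub>R t))"
  let ?\<phi>' = "\<lambda>t. frechet_derivative \<phi> (at (x + (1/2) *\<^sub>R t))"
  define F' where "F' = (\<lambda>t h. 
      exp (\<i> * complex_of_real (t \<bullet> \<xi>)) * \<psi> (x - (1/2) *\<^sub>R t) * ?\<phi>' t ((1/2) *\<^sub>R h) +
      (exp (\<i> * complex_of_real (t \<bullet> \<xi>)) * ?\<psi>' t (- ((1/2) *\<^sub>R h)) +
       exp (\<i> * complex_of_real (t \<bullet> \<xi>)) * (\<i> * complex_of_real (h \<bullet> \<xi>)) * \<psi> (x - (1/2) *\<^sub>R t)) *
      \<phi> (x + (1/2) *\<^sub>R t))"
  have Db: "?D \<psi> \<in> schwartz" "?D \<phi> \<in> schwartz" using assms by (auto intro!: schwartz_pderiv simp del: pderivs.simps)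
  have der: "(f has_derivative frechet_derivative f (at z)) (at z)" if "f \<in> schwartz" for f :: "'v \<Rightarrow> complex" and z
    using smooth_has_derivative[OF schwartz_smooth[OF that], of "[]"] by simp
  have lin: "frechet_derivative f (at z) (c *\<^sub>R h) = of_real c * frechet_derivative f (at z) h"
    if "f \<in> schwartz" for f :: "'v \<Rightarrow> complex" and z c h
    using linear_simps(5)[OF has_derivative_bounded_linear[OF der[OF that]]] by (simp add: scaleR_conv_of_real)
  have deriv: "(?F has_derivative F' t) (at t)" for t
  proof -
    have "((\<lambda>t. \<i> * complex_of_real (t \<bullet> \<xi>)) has_derivative (\<lambda>h. \<i> * complex_of_real (h \<bullet> \<xi>))) (at t)"
      by (auto intro!: derivative_eq_intros)
    from has_derivative_compose[OF this DERIV_exp[unfolded has_field_derivative_def]]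
    have 1: "((\<lambda>t. exp (\<i> * complex_of_real (t \<bullet> \<xi>))) has_derivative
      (\<lambda>h. exp (\<i> * complex_of_real (t \<bullet> \<xi>)) * (\<i> * complex_of_real (h \<bullet> \<xi>)))) (at t)" .
    have 2: "((\<lambda>t. \<psi> (x - (1/2) *\<^sub>R t)) has_derivative (\<lambda>h. ?\<psi>' t (- ((1/2) *\<^sub>R h)))) (at t)"
      by (rule has_derivative_compose[OF _ der[OF assms(1)]]) (auto intro!: derivative_eq_intros)
    have 3: "((\<lambda>t. \<phi> (x + (1/2) *\<^sub>R t)) has_derivative (\<lambda>h. ?\<phi>' t ((1/2) *\<^sub>R h))) (at t)"
      by (rule has_derivative_compose[OF _ der[OF assms(2)]]) (auto intro!: derivative_eq_intros)
    show ?thesis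
      unfolding weyl_integrand_def F'_def
      by (rule has_derivative_mult[OF has_derivative_mult[OF 1 2] 3])
  qed
  have F'b: "F' t b = \<i> * of_real (\<xi> \<bullet> b) * ?F t +
      (- (1/2)) * weyl_integrand (?D \<psi>) \<phi> x \<xi> t + (1/2) * weyl_integrand \<psi> (?D \<phi>) x \<xi> t" for t
    unfolding F'_def weyl_integrand_def lin[OF assms(2)] scaleR_minus_left[symmetric] lin[OF assms(1)]
    by (simp add: algebra_simps inner_commute[of b])
  define A where "A = cmod (\<i> * of_real (\<xi> \<bullet> b)) * (4 ^ Suc ?N * (schwartz_norm ?N \<psi> * schwartz_norm ?N \<phi>))
     + (1/2) * (4 ^ Suc ?N * (schwartz_norm ?N (?D \<psi>) * schwartz_norm ?N \<phi>))
     + (1/2) * (4 ^ Suc ?N * (schwartz_norm ?N \<psi> * schwartz_norm ?N (?D \<phi>)))"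
  define A' where "A' = 4 ^ Suc ?N * (schwartz_norm ?N \<psi> * schwartz_norm ?N \<phi>)"
  have A_bound: "(1 + norm t) ^ ?N * cmod (F' t b) \<le> A" for t
  proof -
    have "(1 + norm t) ^ ?N * cmod (F' t b) \<le> (1 + norm t) ^ ?N *
       (cmod (\<i> * of_real (\<xi> \<bullet> b)) * cmod (?F t) + (1/2) * cmod (weyl_integrand (?D \<psi>) \<phi> x \<xi> t)
        + (1/2) * cmod (weyl_integrand \<psi> (?D \<phi>) x \<xi> t))"
      unfolding F'b by (intro mult_left_mono order_trans[OF norm_triangle_ineq add_mono]
          order_trans[OF norm_triangle_ineq add_mono]) (auto simp: norm_mult)
    also have "\<dots> = cmod (\<i> * of_real (\<xi> \<bullet> b)) * ((1 + norm t) ^ ?N * cmod (?F t))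
        + (1/2) * ((1 + norm t) ^ ?N * cmod (weyl_integrand (?D \<psi>) \<phi> x \<xi> t))
        + (1/2) * ((1 + norm t) ^ ?N * cmod (weyl_integrand \<psi> (?D \<phi>) x \<xi> t))"
      by (simp only: distrib_left mult_ac)
    also have "\<dots> \<le> A"
      unfolding A_def
      by (intro add_mono mult_left_mono weyl_integrand_decay_t assms Db) auto
    finally show ?thesis .
  qed
  have "(LINT t|lborel. F' t b) = 0"
  proof (rule integral_directional_derivative_zero[OF deriv, where C = "max A A'"])
    show "(\<lambda>t. F' t b) \<in> borel_measurable borel"
      unfolding F'b using assms(1,2) Db by measurable
    show "(1 + norm t) ^ ?N * cmod (?F t) \<le> max A A'" for t
      unfolding A'_def by (intro max.coboundedI2 weyl_integrand_decay_t assms)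
    show "(1 + norm t) ^ ?N * cmod (F' t b) \<le> max A A'" for t
      by (intro max.coboundedI1 A_bound)
  qed (use assms in auto)
  moreover have "(LINT t|lborel. F' t b) = \<i> * of_real (\<xi> \<bullet> b) * weyl_kernel \<psi> \<phi> (x, \<xi>) +
      (- (1/2)) * weyl_kernel (?D \<psi>) \<phi> (x, \<xi>) + (1/2) * weyl_kernel \<psi> (?D \<phi>) (x, \<xi>)"
    unfolding F'b weyl_kernel_eq
    by (simp add: integrable_weyl_integrand assms Db del: pderivs.simps)
  ultimately show ?thesis by (simp add: field_simps del: pderivs.simps)
qed

text \<open>Each factor \<open>\<xi> \<bullet> b\<close> costs one derivative. The two terms that it produces are averaged, so the
  constant does not depend on \<open>k\<close>.\<close>

lemma weyl_kernel_decay_component: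
  fixes j
  defines "M \<equiv> j + 2 * DIM('v)"
  fixes \<psi> \<phi> :: "'v::euclidean_space \<Rightarrow> complex"
  assumes "b \<in> Basis" "\<psi> \<in> schwartz" "\<phi> \<in> schwartz"
  shows "(1 + norm x) ^ j * \<bar>\<xi> \<bullet> b\<bar> ^ k * cmod (weyl_kernel \<psi> \<phi> (x, \<xi>)) \<le>
    4 ^ Suc M * (LINT z|lborel. 1 / (1 + norm (z::'v)) ^ (2 * DIM('v))) *
      (schwartz_norm (M + k) \<psi> * schwartz_norm (M + k) \<phi>)"
    (is "_ \<le> ?K * _")
  using assms(3,4)
proof (induction k arbitrary: \<psi> \<phi>)
  case 0
  then show ?case using weyl_kernel_decay_position[of \<psi> \<phi> x j \<xi>] by (simp add: M_def)
next
  case (Suc k)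
  let ?D = "\<lambda>f. pderivs [b] f" and ?P = "schwartz_norm"
  let ?w = "(1 + norm x) ^ j * \<bar>\<xi> \<bullet> b\<bar> ^ k"
  have D: "?D \<psi> \<in> schwartz" "?D \<phi> \<in> schwartz"
    using Suc.prems assms by (auto intro!: schwartz_pderiv simp del: pderivs.simps)
  have K: "0 \<le> ?K" by (intro mult_nonneg_nonneg Bochner_Integration.integral_nonneg) auto
  have "\<bar>\<xi> \<bullet> b\<bar> * cmod (weyl_kernel \<psi> \<phi> (x, \<xi>)) = cmod (\<i> * of_real (\<xi> \<bullet> b) * weyl_kernel \<psi> \<phi> (x, \<xi>))"
    by (simp add: norm_mult)
  also have "\<dots> \<le> (cmod (weyl_kernel (?D \<psi>) \<phi> (x, \<xi>)) + cmod (weyl_kernel \<psi> (?D \<phi>) (x, \<xi>))) / 2"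
    unfolding weyl_kernel_pderiv[OF Suc.prems assms(2)]
    using norm_triangle_ineq4 by (simp add: norm_divide divide_right_mono del: pderivs.simps)
  finally have "?w * (\<bar>\<xi> \<bullet> b\<bar> * cmod (weyl_kernel \<psi> \<phi> (x, \<xi>))) \<le>
     ?w * ((cmod (weyl_kernel (?D \<psi>) \<phi> (x, \<xi>)) + cmod (weyl_kernel \<psi> (?D \<phi>) (x, \<xi>))) / 2)"
    by (intro mult_left_mono) auto
  also have "\<dots> = (?w * cmod (weyl_kernel (?D \<psi>) \<phi> (x, \<xi>)) + ?w * cmod (weyl_kernel \<psi> (?D \<phi>) (x, \<xi>))) / 2"
    by (simp only: distrib_left times_divide_eq_right)
  also have "\<dots> \<le> (?K * (?P (M + k) (?D \<psi>) * ?P (M + k) \<phi>) + ?K * (?P (M + k) \<psi> * ?P (M + k) (?D \<phi>))) / 2"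
    by (intro divide_right_mono add_mono Suc.IH Suc.prems D) auto
  also have "\<dots> \<le> (?K * (?P (M + Suc k) \<psi> * ?P (M + Suc k) \<phi>) + ?K * (?P (M + Suc k) \<psi> * ?P (M + Suc k) \<phi>)) / 2"
    unfolding add_Suc_right
    by (intro divide_right_mono add_mono mult_left_mono mult_mono schwartz_norm_pderiv schwartz_norm_mono
        Suc.prems assms schwartz_norm_nonneg D K) auto
  finally show ?case by (simp add: mult_ac)
qed

text \<open>The powers of \<open>norm \<xi>\<close> are controlled by those of its largest component.\<close>

theorem weyl_kernel_decay:
  obtains C where "C \<ge> 0" and
    "\<And>\<psi> \<phi> (x::'v::euclidean_space) \<xi>. \<psi> \<in> schwartz \<Longrightarrow> \<phi> \<in> schwartz \<Longrightarrow>
      (1 + norm x) ^ j * (1 + norm \<xi>) ^ k * cmod (weyl_kernel \<psi> \<phi> (x, \<xi>)) \<le>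
      C * (schwartz_norm (j + 2 * DIM('v) + k) \<psi> * schwartz_norm (j + 2 * DIM('v) + k) \<phi>)"
proof -
  define M where "M = j + 2 * DIM('v)"
  define K where "K = 4 ^ Suc M * (LINT z|lborel. 1 / (1 + norm (z::'v)) ^ (2 * DIM('v)))"
  have K: "0 \<le> K" unfolding K_def by (intro mult_nonneg_nonneg Bochner_Integration.integral_nonneg) auto
  define c where "c = 2 ^ k * real (DIM('v)) ^ k"
  have c: "0 \<le> c" by (simp add: c_def)
  show thesis
  proof (rule that[of "2 ^ k * K + c * K"])
    show "2 ^ k * K + c * K \<ge> 0" using K by (simp add: c_def)
    fix \<psi> \<phi> :: "'v \<Rightarrow> complex" and x \<xi> :: 'v assume S: "\<psi> \<in> schwartz" "\<phi> \<in> schwartz"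
    let ?W = "cmod (weyl_kernel \<psi> \<phi> (x, \<xi>))"
    let ?P = "schwartz_norm (M + k) \<psi> * schwartz_norm (M + k) \<phi>"
    obtain b where b: "b \<in> Basis" "\<And>e. e \<in> Basis \<Longrightarrow> \<bar>\<xi> \<bullet> e\<bar> \<le> \<bar>\<xi> \<bullet> b\<bar>"
      using Max_in[of "(\<lambda>e. \<bar>\<xi> \<bullet> e\<bar>) ` Basis"] Max_ge[of "(\<lambda>e. \<bar>\<xi> \<bullet> e\<bar>) ` Basis"] by fastforce
    have "norm \<xi> \<le> (\<Sum>e\<in>Basis. \<bar>\<xi> \<bullet> e\<bar>)" by (rule norm_le_l1)
    also have "\<dots> \<le> real (DIM('v)) * \<bar>\<xi> \<bullet> b\<bar>" using b(2) by (rule sum_bounded_above)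
    finally have "norm \<xi> ^ k \<le> (real (DIM('v)) * \<bar>\<xi> \<bullet> b\<bar>) ^ k" by (intro power_mono) auto
    then have "2 ^ k * (1 + norm \<xi> ^ k) \<le> 2 ^ k * (1 + (real (DIM('v)) * \<bar>\<xi> \<bullet> b\<bar>) ^ k)"
      by (intro mult_left_mono add_left_mono) auto
    then have "(1 + norm \<xi>) ^ k \<le> 2 ^ k * (1 + (real (DIM('v)) * \<bar>\<xi> \<bullet> b\<bar>) ^ k)"
      by (rule order_trans[OF one_plus_power_le[OF norm_ge_zero]])
    also have "\<dots> = 2 ^ k + c * \<bar>\<xi> \<bullet> b\<bar> ^ k"
      by (simp add: c_def power_mult_distrib algebra_simps)
    finally have "(1 + norm \<xi>) ^ k \<le> 2 ^ k + c * \<bar>\<xi> \<bullet> b\<bar> ^ k" .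
    then have "(1 + norm x) ^ j * (1 + norm \<xi>) ^ k * ?W \<le> (1 + norm x) ^ j * (2 ^ k + c * \<bar>\<xi> \<bullet> b\<bar> ^ k) * ?W"
      by (intro mult_right_mono mult_left_mono) auto
    also have "\<dots> = 2 ^ k * ((1 + norm x) ^ j * \<bar>\<xi> \<bullet> b\<bar> ^ 0 * ?W) + c * ((1 + norm x) ^ j * \<bar>\<xi> \<bullet> b\<bar> ^ k * ?W)"
      by (simp add: algebra_simps)
    also have "\<dots> \<le> 2 ^ k * (K * (schwartz_norm (M + 0) \<psi> * schwartz_norm (M + 0) \<phi>)) + c * (K * ?P)"
      unfolding K_def M_def
      by (intro add_mono mult_left_mono weyl_kernel_decay_component b S) (auto simp: c_def)
    also have "\<dots> \<le> 2 ^ k * (K * ?P) + c * (K * ?P)"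
      using K c S by (intro add_mono mult_left_mono mult_mono schwartz_norm_mono schwartz_norm_nonneg) auto
    finally show "(1 + norm x) ^ j * (1 + norm \<xi>) ^ k * ?W \<le> (2 ^ k * K + c * K) *
        (schwartz_norm (j + 2 * DIM('v) + k) \<psi> * schwartz_norm (j + 2 * DIM('v) + k) \<phi>)"
      by (simp add: M_def algebra_simps)
  qed
qed

section \<open>Weyl operators with symbols of polynomial growth\<close>

definition slowly_growing :: "('a::euclidean_space \<Rightarrow> complex) \<Rightarrow> bool" where
  "slowly_growing a \<longleftrightarrow> a \<in> borel_measurable borel \<and>
     (\<exists>C\<ge>0. \<exists>p. \<forall>z. cmod (a z) \<le> C * (1 + norm z) ^ p)"

lemma slowly_growing_comp_linear:
  fixes L :: "'a::euclidean_space \<Rightarrow> 'b::euclidean_space"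
  assumes "slowly_growing a" "linear L"
  shows "slowly_growing (\<lambda>z. a (L z))"
proof -
  obtain C p where C: "C \<ge> 0" "\<And>z. cmod (a z) \<le> C * (1 + norm z) ^ p" and [measurable]: "a \<in> borel_measurable borel"
    using assms(1) by (auto simp: slowly_growing_def)
  obtain B where B: "B > 0" "\<And>z. norm (L z) \<le> B * norm z"
    using linear_bounded_pos[OF assms(2)] by auto
  have [measurable]: "L \<in> borel_measurable borel"
    using assms(2) by (intro borel_measurable_continuous_onI linear_continuous_on) (simp add: linear_conv_bounded_linear)
  have "cmod (a (L z)) \<le> C * (1 + B) ^ p * (1 + norm z) ^ p" for z
  proof -
    have "1 + norm (L z) \<le> (1 + B) * (1 + norm z)"
      using B(1) B(2)[of z] by (simp add: algebra_simps add_increasing add_increasing2)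
    then have "(1 + norm (L z)) ^ p \<le> ((1 + B) * (1 + norm z)) ^ p"
      by (intro power_mono) auto
    then have "C * (1 + norm (L z)) ^ p \<le> C * ((1 + B) * (1 + norm z)) ^ p"
      using C(1) by (intro mult_left_mono)
    with C(2)[of "L z"] show ?thesis by (simp add: power_mult_distrib mult.assoc)
  qed
  moreover have "0 \<le> C * (1 + B) ^ p" using B C by simp
  ultimately show ?thesis
    unfolding slowly_growing_def by auto
qed

lemma tempered_distribution_function_distribution:
  fixes a :: "'a::euclidean_space \<Rightarrow> complex"
  assumes "slowly_growing a"
  shows "tempered_distribution (function_distribution a)"
proof -
  let ?N = "2 * DIM('a)"
  obtain C p where C: "C \<ge> 0" "\<And>z. cmod (a z) \<le> C * (1 + norm z) ^ p" and [measurable]: "a \<in> borel_measurable borel"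
    using assms by (auto simp: slowly_growing_def)
  define K where "K = C * 2 ^ Suc (p + ?N)"
  define I where "I = (LINT z|lborel. 1 / (1 + norm (z::'a)) ^ ?N)"
  have meas: "(\<lambda>z. a z * f z) \<in> borel_measurable borel" if "f \<in> schwartz" for f
    using smooth_borel_measurable[OF schwartz_smooth[OF that]] by measurable
  have decay: "(1 + norm z) ^ ?N * cmod (a z * f z) \<le> K * schwartz_norm (p + ?N) f"
    if f: "f \<in> schwartz" for f z
  proof -
    have "(1 + norm z) ^ ?N * cmod (a z * f z) \<le> (1 + norm z) ^ ?N * (C * (1 + norm z) ^ p * cmod (f z))"
      unfolding norm_mult by (intro mult_left_mono mult_right_mono C) auto
    also have "\<dots> = C * ((1 + norm z) ^ (p + ?N) * cmod (pderivs [] f z))"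
      by (simp add: power_add mult_ac)
    also have "\<dots> \<le> C * (2 ^ Suc (p + ?N) * schwartz_norm (p + ?N) f)"
      by (intro mult_left_mono schwartz_decay f C) auto
    finally show ?thesis by (simp add: K_def)
  qed
  note int = integrable_decay[OF meas decay, folded I_def]
  have "cmod (function_distribution a f) \<le> (K * I) * schwartz_norm (p + ?N) f" if "f \<in> schwartz" for f
    unfolding function_distribution_def
    using order_trans[OF integral_norm_bound int(2)[OF that that]] by (simp add: mult_ac)
  then show ?thesis
    unfolding tempered_distribution_def schwartz_norm_def
    using int(1) by (auto simp: function_distribution_def distrib_left mult.left_commute[of "a _"])
qed

lemma one_plus_le_mult:
  fixes a x y :: real
  assumes "a \<le> x + y" "0 \<le> x" "0 \<le> y"
  shows "1 + a \<le> (1 + x) * (1 + y)"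
  using assms(1) mult_nonneg_nonneg[OF assms(2,3)]
  by (simp only: distrib_left distrib_right mult_1_left mult_1_right)

lemma one_plus_norm_Pair_le: "1 + norm (x, y) \<le> (1 + norm x) * (1 + norm y)"
  by (intro one_plus_le_mult norm_Pair_le norm_ge_zero)

lemma integrable_decay_Pair:
  fixes f :: "'a::euclidean_space \<times> 'b::euclidean_space \<Rightarrow> complex"
  assumes "f \<in> borel_measurable borel"
    and "\<And>x y. ((1 + norm x) * (1 + norm y)) ^ (2 * DIM('a \<times> 'b)) * cmod (f (x, y)) \<le> C"
  shows "integrable lborel f"
    and "(LINT z|lborel. cmod (f z)) \<le> C * (LINT z|lborel. 1 / (1 + norm (z::'a \<times> 'b)) ^ (2 * DIM('a \<times> 'b)))"
proof -
  have "(1 + norm z) ^ (2 * DIM('a \<times> 'b)) * cmod (f z) \<le> C" for z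
  proof (cases z)
    case (Pair x y)
    have "(1 + norm (x, y)) ^ (2 * DIM('a \<times> 'b)) * cmod (f (x, y)) \<le>
        ((1 + norm x) * (1 + norm y)) ^ (2 * DIM('a \<times> 'b)) * cmod (f (x, y))"
      by (intro mult_right_mono power_mono one_plus_norm_Pair_le) auto
    also have "\<dots> \<le> C" by (rule assms(2))
    finally show ?thesis unfolding Pair .
  qed
  from integrable_decay[OF assms(1) this]
  show "integrable lborel f"
    and "(LINT z|lborel. cmod (f z)) \<le> C * (LINT z|lborel. 1 / (1 + norm (z::'a \<times> 'b)) ^ (2 * DIM('a \<times> 'b)))" .
qed

lemma weyl_kernel_measurable:
  fixes \<psi> \<phi> :: "'v::euclidean_space \<Rightarrow> complex"
  assumes "\<psi> \<in> schwartz" "\<phi> \<in> schwartz"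
  shows "weyl_kernel \<psi> \<phi> \<in> borel_measurable borel"
proof -
  have "(\<lambda>z. LINT t|lborel. weyl_integrand \<psi> \<phi> (fst z) (snd z) t) \<in> borel_measurable borel"
    unfolding borel_prod[symmetric] using assms by measurable
  then show ?thesis by (simp add: weyl_kernel_eq[symmetric])
qed

text \<open>The kernel is made to decay faster than the symbol grows, with a power to spare that is
  integrable on the phase space; taking this power in each of the two variables dominates it in
  the pair.\<close>

lemma weyl_pairing_bound:
  fixes a :: "'v::euclidean_space \<times> 'v \<Rightarrow> complex"
  assumes "slowly_growing a"
  obtains C M where "C \<ge> 0"
    "\<And>\<psi> \<phi>. \<psi> \<in> schwartz \<Longrightarrow> \<phi> \<in> schwartz \<Longrightarrow> integrable lborel (\<lambda>z. a z * weyl_kernel \<psi> \<phi> z)"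
    "\<And>\<psi> \<phi>. \<psi> \<in> schwartz \<Longrightarrow> \<phi> \<in> schwartz \<Longrightarrow>
      cmod (LINT z|lborel. a z * weyl_kernel \<psi> \<phi> z) \<le> C * (schwartz_norm M \<psi> * schwartz_norm M \<phi>)"
proof -
  let ?N = "2 * DIM('v \<times> 'v)"
  obtain A p where A: "A \<ge> 0" "\<And>z. cmod (a z) \<le> A * (1 + norm z) ^ p" and [measurable]: "a \<in> borel_measurable borel"
    using assms by (auto simp: slowly_growing_def)
  define q where "q = p + ?N"
  define M where "M = q + 2 * DIM('v) + q"
  obtain K where K: "K \<ge> 0" "\<And>\<psi> \<phi> (x::'v) \<xi>. \<psi> \<in> schwartz \<Longrightarrow> \<phi> \<in> schwartz \<Longrightarrow>
      (1 + norm x) ^ q * (1 + norm \<xi>) ^ q * cmod (weyl_kernel \<psi> \<phi> (x, \<xi>)) \<le>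
      K * (schwartz_norm M \<psi> * schwartz_norm M \<phi>)"
    using weyl_kernel_decay[of q q] unfolding M_def by metis
  define I where "I = (LINT z|lborel. 1 / (1 + norm (z::'v \<times> 'v)) ^ ?N)"
  have I: "0 \<le> I" unfolding I_def by (rule Bochner_Integration.integral_nonneg) simp
  have decay: "((1 + norm x) * (1 + norm \<xi>)) ^ ?N * cmod (a (x, \<xi>) * weyl_kernel \<psi> \<phi> (x, \<xi>))
      \<le> A * (K * (schwartz_norm M \<psi> * schwartz_norm M \<phi>))"
    if S: "\<psi> \<in> schwartz" "\<phi> \<in> schwartz" for \<psi> \<phi> x \<xi>
  proof -
    have "cmod (a (x, \<xi>)) \<le> A * ((1 + norm x) * (1 + norm \<xi>)) ^ p"
      by (rule order_trans[OF A(2)]) (intro mult_left_mono power_mono one_plus_norm_Pair_le A, auto)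
    then have "((1 + norm x) * (1 + norm \<xi>)) ^ ?N * cmod (a (x, \<xi>) * weyl_kernel \<psi> \<phi> (x, \<xi>))
      \<le> ((1 + norm x) * (1 + norm \<xi>)) ^ ?N * (A * ((1 + norm x) * (1 + norm \<xi>)) ^ p * cmod (weyl_kernel \<psi> \<phi> (x, \<xi>)))"
      unfolding norm_mult by (intro mult_left_mono mult_right_mono) auto
    also have "\<dots> = A * ((1 + norm x) ^ q * (1 + norm \<xi>) ^ q * cmod (weyl_kernel \<psi> \<phi> (x, \<xi>)))"
      unfolding q_def power_mult_distrib power_add by (simp only: mult_ac)
    also have "\<dots> \<le> A * (K * (schwartz_norm M \<psi> * schwartz_norm M \<phi>))"
      by (intro mult_left_mono K S A)
    finally show ?thesis .
  qed
  have meas: "(\<lambda>z. a z * weyl_kernel \<psi> \<phi> z) \<in> borel_measurable borel"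
    if "\<psi> \<in> schwartz" "\<phi> \<in> schwartz" for \<psi> \<phi>
    using weyl_kernel_measurable[OF that] by measurable
  note int = integrable_decay_Pair[OF meas decay, folded I_def]
  show thesis
  proof (rule that)
    show "0 \<le> A * K * I" using A K I by simp
    fix \<psi> \<phi> :: "'v \<Rightarrow> complex" assume S: "\<psi> \<in> schwartz" "\<phi> \<in> schwartz"
    show "integrable lborel (\<lambda>z. a z * weyl_kernel \<psi> \<phi> z)" by (rule int(1)[OF S S])
    show "cmod (LINT z|lborel. a z * weyl_kernel \<psi> \<phi> z) \<le> A * K * I * (schwartz_norm M \<psi> * schwartz_norm M \<phi>)"
      using order_trans[OF integral_norm_bound int(2)[OF S S]] by (simp add: mult_ac)
  qed
qed

lemma weyl_kernel_linear:
  fixes \<psi> \<phi> :: "'v::euclidean_space \<Rightarrow> complex"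
  assumes "\<psi> \<in> schwartz" "\<phi> \<in> schwartz"
  shows "\<psi>' \<in> schwartz \<Longrightarrow> weyl_kernel (\<lambda>z. \<psi> z + \<psi>' z) \<phi> w = weyl_kernel \<psi> \<phi> w + weyl_kernel \<psi>' \<phi> w"
    and "\<phi>' \<in> schwartz \<Longrightarrow> weyl_kernel \<psi> (\<lambda>z. \<phi> z + \<phi>' z) w = weyl_kernel \<psi> \<phi> w + weyl_kernel \<psi> \<phi>' w"
    and "weyl_kernel (\<lambda>z. c * \<psi> z) \<phi> w = c * weyl_kernel \<psi> \<phi> w"
    and "weyl_kernel \<psi> (\<lambda>z. c * \<phi> z) w = c * weyl_kernel \<psi> \<phi> w"
proof -
  note int = integrable_weyl_integrand
  have add: "weyl_integrand (\<lambda>z. \<psi> z + \<psi>' z) \<phi> x \<xi> t = weyl_integrand \<psi> \<phi> x \<xi> t + weyl_integrand \<psi>' \<phi> x \<xi> t"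
    "weyl_integrand \<psi> (\<lambda>z. \<phi> z + \<phi>' z) x \<xi> t = weyl_integrand \<psi> \<phi> x \<xi> t + weyl_integrand \<psi> \<phi>' x \<xi> t"
    "weyl_integrand (\<lambda>z. c * \<psi> z) \<phi> x \<xi> t = c * weyl_integrand \<psi> \<phi> x \<xi> t"
    "weyl_integrand \<psi> (\<lambda>z. c * \<phi> z) x \<xi> t = c * weyl_integrand \<psi> \<phi> x \<xi> t" for x \<xi> t
    by (simp_all add: weyl_integrand_def algebra_simps)
  show "weyl_kernel (\<lambda>z. \<psi> z + \<psi>' z) \<phi> w = weyl_kernel \<psi> \<phi> w + weyl_kernel \<psi>' \<phi> w" if "\<psi>' \<in> schwartz"
    using assms that by (cases w) (simp add: weyl_kernel_eq add int)
  show "weyl_kernel \<psi> (\<lambda>z. \<phi> z + \<phi>' z) w = weyl_kernel \<psi> \<phi> w + weyl_kernel \<psi> \<phi>' w" if "\<phi>' \<in> schwartz"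
    using assms that by (cases w) (simp add: weyl_kernel_eq add int)
  show "weyl_kernel (\<lambda>z. c * \<psi> z) \<phi> w = c * weyl_kernel \<psi> \<phi> w"
    by (cases w) (simp add: weyl_kernel_eq add)
  show "weyl_kernel \<psi> (\<lambda>z. c * \<phi> z) w = c * weyl_kernel \<psi> \<phi> w"
    by (cases w) (simp add: weyl_kernel_eq add)
qed

text \<open>The bound for the pairing is a product of Schwartz norms. Fixing either function leaves a
  continuity estimate in the other one.\<close>

theorem continuous_linear_operator_weyl:
  fixes A :: "('v::euclidean_space \<Rightarrow> complex) \<Rightarrow> ('v \<Rightarrow> complex) \<Rightarrow> complex"
  assumes "slowly_growing a" "has_weyl_symbol A (function_distribution a)"
  shows "continuous_linear_operator A"
proof -
  let ?c = "complex_of_real (1 / (2 * pi) ^ DIM('v))"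
  have A: "A \<psi> \<phi> = ?c * (LINT z|lborel. a z * weyl_kernel \<psi> \<phi> z)" if "\<psi> \<in> schwartz" "\<phi> \<in> schwartz" for \<psi> \<phi>
    using assms(2) that by (simp add: has_weyl_symbol_def function_distribution_def)
  obtain C M where C: "C \<ge> 0"
    and int: "\<And>\<psi> \<phi>. \<psi> \<in> schwartz \<Longrightarrow> \<phi> \<in> schwartz \<Longrightarrow> integrable lborel (\<lambda>z. a z * weyl_kernel \<psi> \<phi> z)"
    and bound: "\<And>\<psi> \<phi>. \<psi> \<in> schwartz \<Longrightarrow> \<phi> \<in> schwartz \<Longrightarrow>
      cmod (LINT z|lborel. a z * weyl_kernel \<psi> \<phi> z) \<le> C * (schwartz_norm M \<psi> * schwartz_norm M \<phi>)"
    by (rule weyl_pairing_bound[OF assms(1)]) blast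
  have bound': "cmod (A \<psi> \<phi>) \<le> cmod ?c * C * schwartz_norm M \<psi> * schwartz_norm M \<phi>"
    if "\<psi> \<in> schwartz" "\<phi> \<in> schwartz" for \<psi> \<phi>
    using mult_left_mono[OF bound[OF that] norm_ge_zero[of ?c]]
    unfolding A[OF that] norm_mult by (simp only: mult.assoc)
  have lin: "A \<psi> (\<lambda>z. \<phi> z + \<phi>' z) = A \<psi> \<phi> + A \<psi> \<phi>'" "A (\<lambda>z. \<phi> z + \<phi>' z) \<psi> = A \<phi> \<psi> + A \<phi>' \<psi>"
    "A \<psi> (\<lambda>z. d * \<phi> z) = d * A \<psi> \<phi>" "A (\<lambda>z. d * \<phi> z) \<psi> = d * A \<phi> \<psi>"
    if "\<psi> \<in> schwartz" "\<phi> \<in> schwartz" "\<phi>' \<in> schwartz" for \<psi> \<phi> \<phi>' d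
    using that
    by (simp_all add: A weyl_kernel_linear schwartz_add schwartz_cmult distrib_left int mult.left_commute[of _ d])
  show ?thesis
    unfolding continuous_linear_operator_def tempered_distribution_def schwartz_norm_def[symmetric]
  proof (intro conjI ballI allI)
    fix \<psi> :: "'v \<Rightarrow> complex" assume \<psi>: "\<psi> \<in> schwartz"
    show "\<exists>C M. \<forall>f\<in>schwartz. cmod (A \<psi> f) \<le> C * schwartz_norm M f"
      using bound' \<psi> by blast
    have "cmod (A f \<psi>) \<le> (cmod ?c * C * schwartz_norm M \<psi>) * schwartz_norm M f" if "f \<in> schwartz" for f
      using bound'[OF that \<psi>] by (simp only: mult_ac)
    then show "\<exists>C M. \<forall>f\<in>schwartz. cmod (A f \<psi>) \<le> C * schwartz_norm M f"
      by blast
  qed (use lin in auto)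
qed

section \<open>The Bopp symbol and its symplectic map\<close>

definition bopp_symbol :: "('v::euclidean_space \<times> 'v \<Rightarrow> complex) \<Rightarrow> ('v \<times> 'v) \<times> ('v \<times> 'v) \<Rightarrow> complex" where
  "bopp_symbol a = (\<lambda>((x, y), (\<xi>, \<eta>)). a (x - (1/2) *\<^sub>R \<eta>, y + (1/2) *\<^sub>R \<xi>))"

definition first_mode :: "('v \<times> 'v) \<times> ('v \<times> 'v) \<Rightarrow> 'v \<times> 'v" where
  "first_mode z = (fst (fst z), fst (snd z))"

text \<open>The last component \<open>\<xi>/2 - y\<close> is the momentum conjugate to the second position \<open>x + \<eta>/2\<close>.\<close>

definition bopp_symplectic ::
    "('v::euclidean_space \<times> 'v) \<times> ('v \<times> 'v) \<Rightarrow> ('v \<times> 'v) \<times> ('v \<times> 'v)" where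
  "bopp_symplectic = (\<lambda>((x, y), (\<xi>, \<eta>)).
     ((x - (1/2) *\<^sub>R \<eta>, x + (1/2) *\<^sub>R \<eta>), (y + (1/2) *\<^sub>R \<xi>, (1/2) *\<^sub>R \<xi> - y)))"

lemma linear_first_mode: "linear (first_mode :: ('v::euclidean_space \<times> 'v) \<times> ('v \<times> 'v) \<Rightarrow> 'v \<times> 'v)"
  by (rule linearI) (auto simp: first_mode_def)

lemma linear_bopp_symplectic: "linear bopp_symplectic"
  by (rule linearI) (auto simp: bopp_symplectic_def algebra_simps)

lemma bopp_symbol_eq: "bopp_symbol a z = a (first_mode (bopp_symplectic z))"
  by (simp add: bopp_symbol_def first_mode_def bopp_symplectic_def case_prod_unfold)

lemma bopp_symplectic_in_symplectic_group: "bopp_symplectic \<in> symplectic_group"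
  unfolding symplectic_group_def
proof (intro CollectI conjI allI)
  show "linear bopp_symplectic" by (rule linear_bopp_symplectic)
  \<comment> \<open>The inverse map.\<close>
  define g :: "('a \<times> 'a) \<times> ('a \<times> 'a) \<Rightarrow> ('a \<times> 'a) \<times> ('a \<times> 'a)" where
    "g = (\<lambda>((p, q), (r, s)). (((1/2) *\<^sub>R (p + q), (1/2) *\<^sub>R (r - s)), (r + s, q - p)))"
  have half: "(1/2) *\<^sub>R v + (1/2) *\<^sub>R v = v" for v :: 'a
    by (simp flip: scaleR_add_left)
  have "g (bopp_symplectic z) = z" "bopp_symplectic (g z) = z" for z
    by (cases z; auto simp: g_def bopp_symplectic_def algebra_simps half)+
  then show "bij (bopp_symplectic :: ('a \<times> 'a) \<times> ('a \<times> 'a) \<Rightarrow> _)"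
    by (intro o_bij[of g]) (auto simp: fun_eq_iff)
  show "symplectic_form (bopp_symplectic z) (bopp_symplectic w) = symplectic_form z w" for z w :: "('a \<times> 'a) \<times> ('a \<times> 'a)"
    by (cases z; cases w)
       (auto simp: symplectic_form_def bopp_symplectic_def inner_add_left inner_add_right
         inner_diff_left inner_diff_right inner_commute algebra_simps)
qed

lemma slowly_growing_bopp_symbol:
  assumes "slowly_growing a"
  shows "slowly_growing (bopp_symbol a)"
proof -
  have "linear (\<lambda>z. first_mode (bopp_symplectic z))"
    using linear_compose[OF linear_bopp_symplectic linear_first_mode] by (simp add: o_def)
  from slowly_growing_comp_linear[OF assms this] show ?thesis
    by (simp flip: bopp_symbol_eq)
qed

section \<open>Bopp operators as Weyl operators\<close>

lemma lborel_distr_uminus_euclidean: "distr lborel borel uminus = (lborel :: 'a::euclidean_space measure)"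
  using lborel_affine[of "-1" "0 :: 'a"] by (simp add: density_1)

lemma lborel_integral_rotate:
  fixes f :: "'v::euclidean_space \<times> 'v \<Rightarrow> complex"
  assumes f: "f \<in> borel_measurable borel"
  shows "(LINT z|lborel. f z) = (LINT z|lborel. f (snd z, - fst z))"
proof -
  have f' [measurable]: "f \<in> borel_measurable (borel \<Otimes>\<^sub>M borel)" using f by (simp add: borel_prod)
  have "lborel \<Otimes>\<^sub>M (lborel :: 'v measure) = distr lborel borel id \<Otimes>\<^sub>M distr lborel borel uminus"
    by (simp add: lborel_distr_uminus_euclidean id_def distr_id2[of borel lborel])
  also have "\<dots> = distr (lborel \<Otimes>\<^sub>M lborel) (borel \<Otimes>\<^sub>M borel) (\<lambda>(x::'v, y::'v). (id x, - y))"
    by (intro pair_measure_distr) (auto simp: lborel_distr_uminus_euclidean intro: lborel.sigma_finite_measure_axioms)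
  finally have "(LINT z|(lborel \<Otimes>\<^sub>M lborel). f z) = (LINT z|(distr (lborel \<Otimes>\<^sub>M lborel) (borel \<Otimes>\<^sub>M borel) (\<lambda>(x::'v, y::'v). (id x, - y))). f z)"
    by simp
  also have "\<dots> = (LINT z|(lborel \<Otimes>\<^sub>M lborel). f (fst z, - snd z))"
    by (subst integral_distr) (auto simp: case_prod_unfold)
  also have "\<dots> = (LINT (x, y)|(lborel \<Otimes>\<^sub>M lborel). f (y, - x))"
    by (subst lborel_pair.integral_product_swap[symmetric]) (auto simp: case_prod_unfold)
  finally show ?thesis by (simp add: lborel_prod case_prod_unfold)
qed

text \<open>The momentum \<open>\<Xi> = (\<xi>, \<eta>)\<close> solving \<open>w = (x - \<eta>/2, y + \<xi>/2)\<close> for given \<open>X = (x, y)\<close>: up to the factor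
  \<open>2\<close>, the vector \<open>w - X\<close> rotated by a quarter turn.\<close>

definition bopp_momentum :: "'v::euclidean_space \<times> 'v \<Rightarrow> 'v \<times> 'v \<Rightarrow> 'v \<times> 'v" where
  "bopp_momentum X w = (2 *\<^sub>R (snd w - snd X), 2 *\<^sub>R (fst X - fst w))"

lemma bopp_symbol_momentum: "bopp_symbol a (X, bopp_momentum X w) = a w"
  by (cases X) (simp add: bopp_symbol_def bopp_momentum_def algebra_simps case_prod_unfold)

lemma bopp_momentum_measurable [measurable (raw)]:
  fixes f g :: "'a \<Rightarrow> 'v::euclidean_space \<times> 'v"
  assumes "f \<in> borel_measurable M" "g \<in> borel_measurable M"
  shows "(\<lambda>z. bopp_momentum (f z) (g z)) \<in> borel_measurable M"
proof -
  have *: "(\<lambda>p::('v \<times> 'v) \<times> ('v \<times> 'v). bopp_momentum (fst p) (snd p)) \<in> borel_measurable borel"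
    unfolding bopp_momentum_def by (intro borel_measurable_continuous_onI continuous_intros)
  have "(\<lambda>z. (f z, g z)) \<in> M \<rightarrow>\<^sub>M borel"
    using assms unfolding borel_prod[symmetric] by measurable
  from measurable_compose[OF this *] show ?thesis by simp
qed

lemma lborel_integral_bopp_momentum:
  fixes f :: "'v::euclidean_space \<times> 'v \<Rightarrow> complex"
  assumes f: "f \<in> borel_measurable borel"
  shows "(LINT \<Xi>|lborel. f \<Xi>) = 2 ^ DIM('v \<times> 'v) *\<^sub>R (LINT w|lborel. f (bopp_momentum X w))"
proof -
  let ?t = "(- 2 *\<^sub>R snd X, 2 *\<^sub>R fst X)"
  let ?g = "\<lambda>z. f (?t + 2 *\<^sub>R z)"
  have [measurable]: "f \<in> borel_measurable borel" by fact
  have "(LINT \<Xi>|lborel. f \<Xi>) = 2 ^ DIM('v \<times> 'v) *\<^sub>R (LINT z|lborel. ?g z)"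
    using lborel_integral_affine[OF f, of 2 ?t] by simp
  also have "(LINT z|lborel. ?g z) = (LINT w|lborel. ?g (snd w, - fst w))"
    by (rule lborel_integral_rotate) measurable
  also have "(\<lambda>w. ?g (snd w, - fst w)) = (\<lambda>w. f (bopp_momentum X w))"
    by (simp add: bopp_momentum_def algebra_simps)
  finally show ?thesis .
qed

lemma norm_bopp_momentum: "norm (bopp_momentum X w) = 2 * norm (w - X)"
proof -
  have "bopp_momentum X w = 2 *\<^sub>R (snd w - snd X, fst X - fst w)"
    by (simp add: bopp_momentum_def)
  then have "norm (bopp_momentum X w) = 2 * norm (snd w - snd X, fst X - fst w)"
    by (simp only: norm_scaleR abs_numeral)
  also have "norm (snd w - snd X, fst X - fst w) = norm (w - X)"
    by (simp add: norm_Pair norm_prod_def norm_minus_commute[of "fst X"] add.commute)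
  finally show ?thesis .
qed

text \<open>Since \<open>w - X\<close> and half of the momentum have equal norms, decay of the Weyl kernel in \<open>X\<close> and
  momentum gives decay in \<open>X\<close> and \<open>w\<close>. The position carries twice the exponent because it pays for
  its own weight and for its share of the weight of \<open>w\<close>.\<close>

lemma integrable_weyl_kernel_bopp_momentum:
  fixes \<psi> \<phi> :: "'v::euclidean_space \<times> 'v \<Rightarrow> complex"
  assumes a: "slowly_growing a" and S: "\<psi> \<in> schwartz" "\<phi> \<in> schwartz"
  shows "integrable lborel (\<lambda>(X, w). a w * weyl_kernel \<psi> \<phi> (X, bopp_momentum X w))"
proof -
  let ?N = "2 * DIM(('v \<times> 'v) \<times> ('v \<times> 'v))"
  obtain A p where A: "A \<ge> 0" "\<And>z. cmod (a z) \<le> A * (1 + norm z) ^ p" and [measurable]: "a \<in> borel_measurable borel"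
    using assms by (auto simp: slowly_growing_def)
  define q where "q = p + ?N"
  define M where "M = 2 * q + 2 * DIM('v \<times> 'v) + q"
  obtain K where K: "K \<ge> 0" "\<And>\<psi> \<phi> (x::'v \<times> 'v) \<xi>. \<psi> \<in> schwartz \<Longrightarrow> \<phi> \<in> schwartz \<Longrightarrow>
      (1 + norm x) ^ (2 * q) * (1 + norm \<xi>) ^ q * cmod (weyl_kernel \<psi> \<phi> (x, \<xi>)) \<le>
      K * (schwartz_norm M \<psi> * schwartz_norm M \<phi>)"
    unfolding M_def by (rule weyl_kernel_decay[of "2 * q" q]) blast
  have [measurable]: "weyl_kernel \<psi> \<phi> \<in> borel_measurable (borel \<Otimes>\<^sub>M borel)"
    using weyl_kernel_measurable[OF S] by (simp add: borel_prod)
  show ?thesis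
  proof (rule integrable_decay_Pair(1))
    show "(\<lambda>(X, w). a w * weyl_kernel \<psi> \<phi> (X, bopp_momentum X w)) \<in> borel_measurable borel"
      unfolding borel_prod[symmetric, where 'a = "'v \<times> 'v" and 'b = "'v \<times> 'v"] by measurable
    fix X w :: "'v \<times> 'v"
    let ?\<Xi> = "bopp_momentum X w"
    let ?W = "cmod (weyl_kernel \<psi> \<phi> (X, ?\<Xi>))"
    have "norm w \<le> norm X + norm (w - X)" using norm_triangle_ineq[of X "w - X"] by simp
    also have "\<dots> \<le> norm X + norm ?\<Xi>" by (simp add: norm_bopp_momentum)
    finally have "(1 + norm X) * (1 + norm w) \<le> (1 + norm X) * ((1 + norm X) * (1 + norm ?\<Xi>))"
      by (intro mult_left_mono one_plus_le_mult) auto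
    then have w: "((1 + norm X) * (1 + norm w)) ^ q \<le> ((1 + norm X) * ((1 + norm X) * (1 + norm ?\<Xi>))) ^ q"
      by (intro power_mono) auto
    have "1 + norm w \<le> (1 + norm X) * (1 + norm w)"
      by (rule one_plus_le_mult) auto
    then have "A * (1 + norm w) ^ p \<le> A * ((1 + norm X) * (1 + norm w)) ^ p"
      using A(1) by (intro mult_left_mono power_mono) auto
    with A(2)[of w] have A': "cmod (a w) \<le> A * ((1 + norm X) * (1 + norm w)) ^ p"
      by (rule order_trans)
    have "((1 + norm X) * (1 + norm w)) ^ ?N * cmod (a w * weyl_kernel \<psi> \<phi> (X, ?\<Xi>)) \<le>
        ((1 + norm X) * (1 + norm w)) ^ ?N * (A * ((1 + norm X) * (1 + norm w)) ^ p * ?W)"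
      unfolding norm_mult by (intro mult_left_mono mult_right_mono A') auto
    also have "\<dots> = A * (((1 + norm X) * (1 + norm w)) ^ q * ?W)"
      unfolding q_def power_add by (simp only: mult_ac)
    also have "\<dots> \<le> A * (((1 + norm X) * ((1 + norm X) * (1 + norm ?\<Xi>))) ^ q * ?W)"
      by (intro mult_left_mono mult_right_mono w A) auto
    also have "\<dots> = A * ((1 + norm X) ^ (2 * q) * (1 + norm ?\<Xi>) ^ q * ?W)"
      by (simp only: power_mult_distrib mult_2 power_add mult.assoc)
    also have "\<dots> \<le> A * (K * (schwartz_norm M \<psi> * schwartz_norm M \<phi>))"
      by (intro mult_left_mono K S A)
    finally show "((1 + norm X) * (1 + norm w)) ^ ?N * cmod (case (X, w) of (X, w) \<Rightarrow> a w * weyl_kernel \<psi> \<phi> (X, bopp_momentum X w))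
        \<le> A * (K * (schwartz_norm M \<psi> * schwartz_norm M \<phi>))" by simp
  qed
qed

definition moyal_integrand ::
    "('v::euclidean_space \<times> 'v \<Rightarrow> complex) \<Rightarrow> ('v \<times> 'v \<Rightarrow> complex) \<Rightarrow> 'v \<times> 'v \<Rightarrow> 'v \<times> 'v \<Rightarrow> 'v \<times> 'v \<Rightarrow> complex" where
  "moyal_integrand \<Psi> \<Phi> w z v =
     exp (- \<i> * complex_of_real (symplectic_form v (w - z))) * \<Psi> (z - (1/2) *\<^sub>R v) * \<Phi> z"

text \<open>The substitution \<open>X = z - t/2\<close>, \<open>v = 2 t\<close> behind the comparison of the two kernels: the shift of
  \<open>X\<close> enters the phase as a pairing of \<open>t\<close> with its own quarter turn, which vanishes.\<close>

lemma moyal_integrand_eq: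
  "moyal_integrand \<psi> \<phi> w z (2 *\<^sub>R t) =
     weyl_integrand \<psi> \<phi> (z - (1/2) *\<^sub>R t) (bopp_momentum (z - (1/2) *\<^sub>R t) w) t"
proof -
  have "- symplectic_form (2 *\<^sub>R t) (w - z) = t \<bullet> bopp_momentum (z - (1/2) *\<^sub>R t) w"
    by (cases t; cases w; cases z)
       (simp add: symplectic_form_def bopp_momentum_def inner_diff_left inner_diff_right inner_add_left inner_add_right inner_commute algebra_simps)
  then have "exp (- \<i> * complex_of_real (symplectic_form (2 *\<^sub>R t) (w - z))) =
      exp (\<i> * complex_of_real (t \<bullet> bopp_momentum (z - (1/2) *\<^sub>R t) w))"
    by (metis minus_mult_commute of_real_minus)
  moreover have half: "z - (1/2) *\<^sub>R t - (1/2) *\<^sub>R t = z - t"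
    by (simp add: diff_diff_eq scaleR_half_double[of t] flip: scaleR_add_left)
  ultimately show ?thesis
    unfolding moyal_integrand_def weyl_integrand_def half by simp
qed

lemma moyal_integrand_measurable:
  assumes "\<psi> \<in> schwartz" "\<phi> \<in> schwartz"
  shows "(\<lambda>(z, v). moyal_integrand \<psi> \<phi> w z v) \<in> borel_measurable borel"
proof (rule borel_measurable_continuous_onI)
  have "continuous_on UNIV \<psi>" "continuous_on UNIV \<phi>"
    using assms by (auto intro!: smooth_continuous_on schwartz_smooth)
  then have *: "continuous_on UNIV (\<lambda>z. \<psi> (f z))" "continuous_on UNIV (\<lambda>z. \<phi> (f z))"
    if "continuous_on UNIV f" for f :: "('a \<times> 'a) \<times> ('a \<times> 'a) \<Rightarrow> 'a \<times> 'a"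
    using that by (auto intro: continuous_on_compose2)
  show "continuous_on UNIV (\<lambda>(z, v). moyal_integrand \<psi> \<phi> w z v)"
    unfolding moyal_integrand_def symplectic_form_def case_prod_unfold by (intro continuous_intros *)
qed

text \<open>Here \<open>z\<close> and \<open>u = z - v/2\<close> are the arguments of the two functions, and \<open>v = 2 (z - u)\<close>.\<close>

lemma integrable_moyal_integrand:
  fixes \<psi> \<phi> :: "'v::euclidean_space \<times> 'v \<Rightarrow> complex"
  assumes S: "\<psi> \<in> schwartz" "\<phi> \<in> schwartz"
  shows "integrable lborel (\<lambda>(z, v). moyal_integrand \<psi> \<phi> w z v)"
proof (rule integrable_decay_Pair(1)[OF moyal_integrand_measurable[OF S]])
  fix z v :: "'v \<times> 'v"
  let ?N = "2 * DIM(('v \<times> 'v) \<times> ('v \<times> 'v))"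
  let ?u = "z - (1/2) *\<^sub>R v"
  have "v = 2 *\<^sub>R (z - ?u)" by simp
  then have "norm v = 2 * norm (z - ?u)" by (metis norm_scaleR abs_numeral)
  also have "\<dots> \<le> 2 * (norm z + norm ?u)" by (intro mult_left_mono norm_triangle_ineq4) auto
  finally have v: "norm v \<le> 2 * (norm z + norm ?u)" .
  have double: "1 + b \<le> 2 * c" if "b \<le> 2 * s" "1 + s \<le> c" for b c s :: real
    using that by linarith
  have "1 + norm v \<le> 2 * ((1 + norm z) * (1 + norm ?u))"
    by (rule double[OF v one_plus_le_mult]) auto
  then have "(1 + norm z) * (1 + norm v) \<le> (1 + norm z) * (2 * ((1 + norm z) * (1 + norm ?u)))"
    by (intro mult_left_mono) auto
  then have "((1 + norm z) * (1 + norm v)) ^ ?N \<le> ((1 + norm z) * (2 * ((1 + norm z) * (1 + norm ?u)))) ^ ?N"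
    by (intro power_mono) auto
  then have "((1 + norm z) * (1 + norm v)) ^ ?N * cmod (moyal_integrand \<psi> \<phi> w z v)
      \<le> ((1 + norm z) * (2 * ((1 + norm z) * (1 + norm ?u)))) ^ ?N * (cmod (\<psi> ?u) * cmod (\<phi> z))"
    unfolding moyal_integrand_def norm_mult by (intro mult_mono) auto
  also have "\<dots> = 2 ^ ?N * (((1 + norm ?u) ^ ?N * cmod (pderivs [] \<psi> ?u)) * ((1 + norm z) ^ (?N + ?N) * cmod (pderivs [] \<phi> z)))"
    unfolding power_mult_distrib power_add pderivs.simps(1) by (simp only: mult_ac)
  also have "\<dots> \<le> 2 ^ ?N * ((2 ^ Suc ?N * schwartz_norm ?N \<psi>) * (2 ^ Suc (?N + ?N) * schwartz_norm (?N + ?N) \<phi>))"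
    using S by (intro mult_left_mono mult_mono schwartz_decay mult_nonneg_nonneg schwartz_norm_nonneg) auto
  finally show "((1 + norm z) * (1 + norm v)) ^ ?N * cmod (case (z, v) of (z, v) \<Rightarrow> moyal_integrand \<psi> \<phi> w z v)
     \<le> 2 ^ ?N * ((2 ^ Suc ?N * schwartz_norm ?N \<psi>) * (2 ^ Suc (?N + ?N) * schwartz_norm (?N + ?N) \<phi>))"
    by simp
qed

lemma integrable_weyl_integrand_bopp_momentum:
  fixes \<psi> \<phi> :: "'v::euclidean_space \<times> 'v \<Rightarrow> complex"
  assumes S: "\<psi> \<in> schwartz" "\<phi> \<in> schwartz"
  shows "integrable lborel (\<lambda>(X, t). weyl_integrand \<psi> \<phi> X (bopp_momentum X w) t)"
proof (rule integrable_decay_Pair(1))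
  let ?N = "2 * DIM(('v \<times> 'v) \<times> ('v \<times> 'v))"
  show "(\<lambda>(X, t). weyl_integrand \<psi> \<phi> X (bopp_momentum X w) t) \<in> borel_measurable borel"
    unfolding borel_prod[symmetric, where 'a = "'v \<times> 'v" and 'b = "'v \<times> 'v"] using S by measurable
  show "((1 + norm X) * (1 + norm t)) ^ ?N * cmod (case (X, t) of (X, t) \<Rightarrow> weyl_integrand \<psi> \<phi> X (bopp_momentum X w) t)
     \<le> 4 ^ Suc (?N + ?N) * (schwartz_norm (?N + ?N) \<psi> * schwartz_norm (?N + ?N) \<phi>)" for X t
    using weyl_integrand_decay[OF S, of X ?N t ?N "bopp_momentum X w"]
    by (simp add: power_mult_distrib)
qed

text \<open>Integrating the Weyl kernel over \<open>X\<close> with \<open>w\<close> fixed, interchanging the integrals over \<open>X\<close> and \<open>t\<close>,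
  and substituting \<open>z = X + t/2\<close> and then \<open>v = 2 t\<close> gives the Moyal kernel. The last step accounts
  for the power of \<open>2\<close>.\<close>

lemma moyal_kernel_eq_weyl_kernel:
  fixes \<psi> \<phi> :: "'v::euclidean_space \<times> 'v \<Rightarrow> complex"
  assumes S: "\<psi> \<in> schwartz" "\<phi> \<in> schwartz"
  shows "moyal_kernel \<psi> \<phi> w = complex_of_real (1 / (2 * pi) ^ DIM('v \<times> 'v)) *
    (2 ^ DIM('v \<times> 'v) *\<^sub>R (LINT X|lborel. weyl_kernel \<psi> \<phi> (X, bopp_momentum X w)))"
proof -
  let ?D = "DIM('v \<times> 'v)"
  let ?H = "\<lambda>X t. weyl_integrand \<psi> \<phi> X (bopp_momentum X w) t"
  have H_meas: "(\<lambda>X. ?H X t) \<in> borel_measurable borel" for t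
    using S by measurable
  have [measurable]: "(\<lambda>(z, v). moyal_integrand \<psi> \<phi> w z v) \<in> borel_measurable (borel \<Otimes>\<^sub>M borel)"
    using moyal_integrand_measurable[OF S] by (simp add: borel_prod)
  have F_meas: "(\<lambda>v. LINT z|lborel. moyal_integrand \<psi> \<phi> w z v) \<in> borel_measurable borel"
    by measurable
  have int: "integrable (lborel \<Otimes>\<^sub>M lborel) (\<lambda>(z, v). moyal_integrand \<psi> \<phi> w z v)"
    using integrable_moyal_integrand[OF S, of w] by (simp only: lborel_prod)
  have "(LINT X|lborel. weyl_kernel \<psi> \<phi> (X, bopp_momentum X w)) = (LINT X|lborel. LINT t|lborel. ?H X t)"
    by (simp add: weyl_kernel_eq)
  also have "\<dots> = (LINT t|lborel. LINT X|lborel. ?H X t)"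
    using integrable_weyl_integrand_bopp_momentum[OF S, of w]
    by (intro lborel_pair.Fubini_integral[symmetric]) (simp add: lborel_prod)
  also have "\<dots> = (LINT t|lborel. LINT z|lborel. moyal_integrand \<psi> \<phi> w z (2 *\<^sub>R t))"
    unfolding moyal_integrand_eq
  proof (rule Bochner_Integration.integral_cong[OF refl])
    fix t
    show "(LINT X|lborel. ?H X t) = (LINT z|lborel. ?H (z - (1/2) *\<^sub>R t) t)"
      using lborel_integral_affine[OF H_meas[of t], of 1 "- ((1/2) *\<^sub>R t)"] by simp
  qed
  finally have "2 ^ ?D *\<^sub>R (LINT X|lborel. weyl_kernel \<psi> \<phi> (X, bopp_momentum X w)) =
      (LINT v|lborel. LINT z|lborel. moyal_integrand \<psi> \<phi> w z v)"
    using lborel_integral_affine[OF F_meas, of 2 0] by simp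
  also have "\<dots> = (LINT (z, v)|lborel. moyal_integrand \<psi> \<phi> w z v)"
    using lborel_pair.integral_snd[OF int] unfolding lborel_prod .
  finally have *: "2 ^ ?D *\<^sub>R (LINT X|lborel. weyl_kernel \<psi> \<phi> (X, bopp_momentum X w)) =
      (LINT (z, v)|lborel. moyal_integrand \<psi> \<phi> w z v)" .
  have dim: "?D = 2 * DIM('v)" by simp
  show ?thesis
    unfolding * unfolding moyal_kernel_def moyal_integrand_def dim ..
qed

theorem has_weyl_symbol_bopp_operator:
  fixes a :: "'v::euclidean_space \<times> 'v \<Rightarrow> complex"
  assumes a: "slowly_growing a"
  shows "has_weyl_symbol (bopp_operator (function_distribution a)) (function_distribution (bopp_symbol a))"
  unfolding has_weyl_symbol_def
proof (intro conjI ballI)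
  show "tempered_distribution (function_distribution (bopp_symbol a))"
    by (rule tempered_distribution_function_distribution[OF slowly_growing_bopp_symbol[OF a]])
  fix \<psi> \<phi> :: "'v \<times> 'v \<Rightarrow> complex" assume S: "\<psi> \<in> schwartz" "\<phi> \<in> schwartz"
  let ?c = "complex_of_real (1 / (2 * pi) ^ DIM('v \<times> 'v))"
  let ?W = "weyl_kernel \<psi> \<phi>" and ?d = "2 ^ DIM('v \<times> 'v) :: real"
  have int: "integrable lborel (\<lambda>z. bopp_symbol a z * ?W z)"
    by (rule weyl_pairing_bound[OF slowly_growing_bopp_symbol[OF a]]) (use S in blast)
  have meas: "(\<lambda>z. bopp_symbol a z * ?W z) \<in> borel_measurable (borel \<Otimes>\<^sub>M borel)"
    using borel_measurable_integrable[OF int] by (simp add: borel_prod)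
  have int': "integrable (lborel \<Otimes>\<^sub>M lborel) (\<lambda>(X, w). a w * ?W (X, bopp_momentum X w))"
    using integrable_weyl_kernel_bopp_momentum[OF a S] by (simp add: lborel_prod)
  have "(LINT z|lborel. bopp_symbol a z * ?W z) = (LINT X|lborel. LINT \<Xi>|lborel. bopp_symbol a (X, \<Xi>) * ?W (X, \<Xi>))"
    using int lborel_pair.integral_fst'[of "\<lambda>z. bopp_symbol a z * ?W z"] by (simp add: lborel_prod)
  also have "\<dots> = (LINT X|lborel. ?d *\<^sub>R (LINT w|lborel. a w * ?W (X, bopp_momentum X w)))"
  proof (rule Bochner_Integration.integral_cong[OF refl])
    fix X :: "'v \<times> 'v"
    have "(\<lambda>\<Xi>. bopp_symbol a (X, \<Xi>) * ?W (X, \<Xi>)) \<in> borel_measurable borel"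
      using measurable_compose[OF measurable_Pair1' meas, of X] by simp
    from lborel_integral_bopp_momentum[OF this, of X]
    show "(LINT \<Xi>|lborel. bopp_symbol a (X, \<Xi>) * ?W (X, \<Xi>)) = ?d *\<^sub>R (LINT w|lborel. a w * ?W (X, bopp_momentum X w))"
      by (simp add: bopp_symbol_momentum)
  qed
  also have "\<dots> = ?d *\<^sub>R (LINT X|lborel. LINT w|lborel. a w * ?W (X, bopp_momentum X w))"
    by simp
  also have "(LINT X|lborel. LINT w|lborel. a w * ?W (X, bopp_momentum X w)) =
      (LINT w|lborel. LINT X|lborel. a w * ?W (X, bopp_momentum X w))"
    by (rule lborel_pair.Fubini_integral[symmetric, OF int'])
  finally have "?c * (LINT z|lborel. bopp_symbol a z * ?W z) =
      ?c * (?d *\<^sub>R (LINT w|lborel. a w * (LINT X|lborel. ?W (X, bopp_momentum X w))))"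
    by simp
  also have "\<dots> = (LINT w|lborel. a w * moyal_kernel \<psi> \<phi> w)"
    unfolding moyal_kernel_eq_weyl_kernel[OF S]
    by (simp add: scaleR_conv_of_real mult.left_commute[of "a _"] del: DIM_prod)
  finally show "bopp_operator (function_distribution a) \<psi> \<phi> = ?c * function_distribution (bopp_symbol a) (weyl_kernel \<psi> \<phi>)"
    by (simp add: bopp_operator_def moyal_product_def function_distribution_def)
qed

section \<open>Bopp operators of Shubin symbols\<close>

lemma shubin_class_slowly_growing:
  assumes "a \<in> shubin_class \<rho> m1 m0"
  shows "slowly_growing a"
proof -
  from assms obtain R0 C1 where smooth: "smooth a" and R0: "C1 > 0"
    "\<And>z. norm z \<ge> R0 \<Longrightarrow> cmod (a z) \<le> C1 * norm z powr m1"
    unfolding shubin_class_iff by blast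
  \<comment> \<open>Beyond radius one, the real exponent \<open>m1\<close> may be rounded up, even if it is negative.\<close>
  define R where "R = max R0 1"
  have R: "1 \<le> R" "\<And>z. norm z \<ge> R \<Longrightarrow> cmod (a z) \<le> C1 * norm z powr m1"
    using R0(2) by (auto simp: R_def)
  have "compact (a ` cball 0 R)"
    by (intro compact_continuous_image smooth_continuous_on smooth) auto
  then have "bounded (a ` cball 0 R)" by (rule compact_imp_bounded)
  then obtain B where B: "\<And>z. norm z \<le> R \<Longrightarrow> cmod (a z) \<le> B"
    unfolding bounded_iff by (meson image_eqI mem_cball_0)
  define p where "p = nat \<lceil>m1\<rceil>"
  have "cmod (a z) \<le> (\<bar>B\<bar> + C1) * (1 + norm z) ^ p" for z
  proof (cases "norm z \<le> R")
    case True
    have "cmod (a z) * 1 \<le> (\<bar>B\<bar> + C1) * (1 + norm z) ^ p"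
      using B[OF True] R0(1) by (intro mult_mono one_le_power) auto
    then show ?thesis by simp
  next
    case False
    then have z: "1 \<le> norm z" using R(1) by linarith
    have "m1 \<le> real p" unfolding p_def by linarith
    then have "norm z powr m1 \<le> norm z powr real p"
      using z by (rule powr_mono)
    also have "\<dots> = norm z ^ p" using z by (intro powr_realpow) linarith
    also have "\<dots> \<le> (1 + norm z) ^ p" by (intro power_mono) auto
    finally have "C1 * norm z powr m1 \<le> C1 * (1 + norm z) ^ p"
      using R0(1) by (intro mult_left_mono) auto
    then have "cmod (a z) \<le> C1 * (1 + norm z) ^ p"
      using R(2)[of z] False by linarith
    also have "\<dots> \<le> (\<bar>B\<bar> + C1) * (1 + norm z) ^ p"
      by (intro mult_right_mono) auto
    finally show ?thesis .
  qed
  then show ?thesis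
    unfolding slowly_growing_def using smooth_borel_measurable[OF smooth] R0(1)
    by (intro conjI exI[of _ "\<bar>B\<bar> + C1"]) auto
qed

lemma coord_proj_first_factor:
  "coord_proj ((\<lambda>b. (b, 0)) ` Basis) p = (fst p, 0)" for p :: "'v::euclidean_space \<times> 'v"
proof -
  have "coord_proj ((\<lambda>b. (b, 0)) ` Basis) p = (\<Sum>b\<in>Basis. (p \<bullet> (b, 0)) *\<^sub>R (b, 0))"
    unfolding coord_proj_def by (subst sum.reindex) (auto simp: inj_on_def)
  also have "\<dots> = (fst p, 0)"
    by (simp add: prod_eq_iff fst_sum snd_sum inner_prod_def euclidean_representation)
  finally show ?thesis .
qed

lemma coord_proj_phase_coords:
  fixes B :: "'v::euclidean_space set"
  assumes "B \<subseteq> Basis"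
  shows "coord_proj (phase_coords B) z = (coord_proj B (fst z), coord_proj B (snd z))"
proof -
  have fin: "finite B" using assms finite_Basis by (rule finite_subset)
  have "coord_proj (phase_coords B) z =
      (\<Sum>b\<in>B. (z \<bullet> (b, 0)) *\<^sub>R (b, 0)) + (\<Sum>b\<in>B. (z \<bullet> (0, b)) *\<^sub>R (0, b))"
    unfolding coord_proj_def phase_coords_def using fin assms
    by (subst sum.union_disjoint) (auto simp: sum.reindex inj_on_def)
  then show ?thesis
    by (simp add: coord_proj_def prod_eq_iff fst_sum snd_sum inner_prod_def)
qed

text \<open>On the span of the selected coordinates the projection \<open>first_mode\<close> is an isometry that maps
  the selected basis vectors to basis vectors, so every estimate keeps its constants.\<close>

lemma shubin_class_first_mode:
  fixes a :: "'v::euclidean_space \<times> 'v \<Rightarrow> complex"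
  assumes "a \<in> shubin_class \<rho> m1 m0"
  shows "(\<lambda>z. a (first_mode z)) \<in> shubin_class_on (phase_coords ((\<lambda>b. (b, 0)) ` Basis)) \<rho> m1 m0"
proof -
  let ?D = "phase_coords ((\<lambda>b::'v. (b, 0::'v)) ` Basis)"
  have "(\<lambda>b::'v. (b, 0::'v)) ` Basis \<subseteq> Basis" by (auto simp: Basis_prod_def)
  then have proj: "(\<lambda>z. a (first_mode z)) \<circ> coord_proj ?D = (\<lambda>z. a (first_mode z))"
    by (simp add: fun_eq_iff coord_proj_phase_coords coord_proj_first_factor first_mode_def)
  have Basis: "first_mode ` ?D \<subseteq> Basis"
    by (auto simp: phase_coords_def first_mode_def Basis_prod_def)
  have "span ?D \<subseteq> {z. snd (fst z) = 0 \<and> snd (snd z) = 0}"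
    by (intro span_minimal subspaceI) (auto simp: phase_coords_def)
  then have norm_eq: "norm (first_mode z) = norm z" if "z \<in> span ?D" for z
    using that by (auto simp: norm_prod_def first_mode_def)
  from assms obtain R C0 C1 where smooth: "smooth a" and R: "R > 0" "C0 > 0" "C1 > 0"
    and growth: "\<And>z. norm z \<ge> R \<Longrightarrow> C0 * norm z powr m0 \<le> cmod (a z) \<and> cmod (a z) \<le> C1 * norm z powr m1"
    and deriv: "\<And>bs. bs \<in> lists Basis \<Longrightarrow> \<exists>C\<ge>0. \<forall>z. norm z \<ge> R \<longrightarrow>
      cmod (pderivs bs a z) \<le> C * cmod (a z) * norm z powr (- \<rho> * real (length bs))"
    unfolding shubin_class_iff by metis
  have "\<exists>C\<ge>0. \<forall>z\<in>span ?D. norm z \<ge> R \<longrightarrow> cmod (pderivs bs (\<lambda>z. a (first_mode z)) z)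
      \<le> C * cmod (a (first_mode z)) * norm z powr (- \<rho> * real (length bs))" if "bs \<in> lists ?D" for bs
  proof -
    have bs: "first_mode ` set bs \<subseteq> Basis" using that Basis by auto
    then have "map first_mode bs \<in> lists Basis" by auto
    from deriv[OF this] obtain C where C: "C \<ge> 0" "\<And>z. norm z \<ge> R \<Longrightarrow>
      cmod (pderivs (map first_mode bs) a z) \<le> C * cmod (a z) * norm z powr (- \<rho> * real (length bs))"
      by auto
    have "cmod (pderivs bs (\<lambda>z. a (first_mode z)) z)
      \<le> C * cmod (a (first_mode z)) * norm z powr (- \<rho> * real (length bs))" if "z \<in> span ?D" "norm z \<ge> R" for z
      using C(2)[of "first_mode z"] that
      by (simp add: pderivs_comp_linear_Basis[OF smooth linear_first_mode bs] norm_eq)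
    with C(1) show ?thesis by blast
  qed
  moreover have "\<forall>z\<in>span ?D. norm z \<ge> R \<longrightarrow> C0 * norm z powr m0 \<le> cmod (a (first_mode z)) \<and>
      cmod (a (first_mode z)) \<le> C1 * norm z powr m1"
    using growth norm_eq by metis
  ultimately show ?thesis
    unfolding shubin_class_on_def mem_Collect_eq proj
    using R smooth_comp_linear[OF smooth linear_first_mode] by blast
qed

text \<open>The number \<open>k\<close> of discarded degrees of freedom is \<open>DIM('v)\<close>, half of those of the doubled space.\<close>

theorem bopp_operator_in_extended_shubin_class:
  fixes a :: "'v::euclidean_space \<times> 'v \<Rightarrow> complex"
  assumes "a \<in> shubin_class \<rho> m1 m0"
  shows "bopp_operator (function_distribution a) \<in> extended_shubin_class \<rho> m1 m0"
proof -
  let ?B = "(\<lambda>b::'v. (b, 0::'v)) ` Basis"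
  let ?a = "\<lambda>z. a (first_mode z)"
  have growing: "slowly_growing a" by (rule shubin_class_slowly_growing[OF assms])
  have smooth: "smooth a" using assms by (simp add: shubin_class_iff)
  have lin: "linear (\<lambda>z::('v \<times> 'v) \<times> ('v \<times> 'v). first_mode (bopp_symplectic z))"
    using linear_compose[OF linear_bopp_symplectic linear_first_mode] by (simp add: o_def)
  have symbol: "bopp_symbol a = (\<lambda>z. a (first_mode (bopp_symplectic z)))"
    by (simp add: fun_eq_iff bopp_symbol_eq)
  have ext: "symplectic_extension ?B bopp_symplectic ?a = bopp_symbol a"
    by (simp add: fun_eq_iff symbol symplectic_extension_def tensor_one_def case_prod_unfold
        coord_proj_first_factor first_mode_def)
  have weyl: "has_weyl_symbol (bopp_operator (function_distribution a)) (function_distribution (bopp_symbol a))"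
    by (rule has_weyl_symbol_bopp_operator[OF growing])
  show ?thesis
    unfolding extended_shubin_class_def
  proof (intro CollectI conjI exI)
    show "continuous_linear_operator (bopp_operator (function_distribution a))"
      by (rule continuous_linear_operator_weyl[OF slowly_growing_bopp_symbol[OF growing] weyl])
    show "DIM('v) \<le> DIM('v \<times> 'v) - 1" using DIM_positive[where 'a = 'v] by simp
    show "?B \<subseteq> Basis" by (auto simp: Basis_prod_def)
    show "card ?B = DIM('v \<times> 'v) - DIM('v)" by (subst card_image) (auto simp: inj_on_def)
    show "?a \<in> shubin_class_on (phase_coords ?B) \<rho> m1 m0" by (rule shubin_class_first_mode[OF assms])
    show "bopp_symplectic \<in> symplectic_group" by (rule bopp_symplectic_in_symplectic_group)
    show "smooth (symplectic_extension ?B bopp_symplectic ?a)"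
      unfolding ext symbol by (rule smooth_comp_linear[OF smooth lin])
    show "has_weyl_symbol (bopp_operator (function_distribution a))
        (function_distribution (symplectic_extension ?B bopp_symplectic ?a))"
      unfolding ext by (rule weyl)
  qed
qed

theorem proposition27:
  fixes a :: "(real^'n) \<times> (real^'n) \<Rightarrow> complex" and m0 m1 \<rho> :: real
  assumes "m0 \<le> m1" and "0 < \<rho>" and "\<rho> \<le> 1"
    and "a \<in> shubin_class \<rho> m1 m0"
  shows "bopp_operator (function_distribution a) \<in> extended_shubin_class \<rho> m1 m0"
  using assms(4) by (rule bopp_operator_in_extended_shubin_class)

end
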